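(* Let $Q$ be a super-perfect group, let $F$ be a free group, and let $1\to R\to F\xrightarrow{p} Q\to 1$ be a short exact sequence of groups. Let $F\times_Q F=\{(x,y)\in F\times F : p(x)=p(y)\}$ be the fiber product over $p\colon F\twoheadrightarrow Q$. Then: (1) The inclusion homomorphism $F\times_Q F\to F\times F$ is homologically $2$-connected. (2) If $\ker\{H_2(F\times_Q F)\to H_2(F\times F)\}=0$, where the map is induced by the inclusion, then $H_3(Q)=0$.
   Context: Homology of groups is with trivial integer coefficients. A group $Q$ is super-perfect if $H_1(Q)=H_2(Q)=0$. A homomorphism $A\to B$ is homologically $2$-connected if it induces an isomorphism $H_1(A)\to H_1(B)$ and an epimorphism $H_2(A)\to H_2(B)$. *)

theory Defs
  imports "HOL-Algebra.Algebra"
begin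

section \<open>Integral group homology via the bar complex\<close>

text \<open>
  The group \<open>C\<^sub>n(G)\<close> of (unnormalised, inhomogeneous) bar chains is the free abelian group on
  \<open>n\<close>-tuples \<open>[g\<^sub>1, \<dots>, g\<^sub>n]\<close> of elements of \<open>G\<close>. This is the bar resolution of \<open>\<int>\<close> over the group
  ring, tensored with the trivial module \<open>\<int>\<close>, so \<open>g\<^sub>1\<close> acts trivially in the zeroth face.
\<close>

definition bar_chain_group :: "nat \<Rightarrow> ('a, 'm) monoid_scheme \<Rightarrow> ('a list \<Rightarrow>\<^sub>0 int) monoid" where
  "bar_chain_group n G = free_Abelian_group {gs. length gs = n \<and> set gs \<subseteq> carrier G}"

definition bar_face :: "('a, 'm) monoid_scheme \<Rightarrow> nat \<Rightarrow> 'a list \<Rightarrow> 'a list" where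
  "bar_face G i gs =
    (if i = 0 then tl gs
     else if i = length gs then butlast gs
     else take (i - 1) gs @ (gs ! (i - 1) \<otimes>\<^bsub>G\<^esub> gs ! i) # drop (i + 1) gs)"

definition bar_boundary ::
    "('a, 'm) monoid_scheme \<Rightarrow> ('a list \<Rightarrow>\<^sub>0 int) \<Rightarrow> ('a list \<Rightarrow>\<^sub>0 int)" where
  "bar_boundary G = frag_extend (\<lambda>gs. if gs = [] then 0
     else (\<Sum>i\<le>length gs. frag_cmul ((-1) ^ i) (frag_of (bar_face G i gs))))"

definition bar_cycle_group :: "nat \<Rightarrow> ('a, 'm) monoid_scheme \<Rightarrow> ('a list \<Rightarrow>\<^sub>0 int) monoid" where
  "bar_cycle_group n G = subgroup_generated (bar_chain_group n G)
     {c \<in> carrier (bar_chain_group n G). bar_boundary G c = 0}"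

definition bar_boundaries :: "nat \<Rightarrow> ('a, 'm) monoid_scheme \<Rightarrow> ('a list \<Rightarrow>\<^sub>0 int) set" where
  "bar_boundaries n G = bar_boundary G ` carrier (bar_chain_group (Suc n) G)"

definition group_homology :: "nat \<Rightarrow> ('a, 'm) monoid_scheme \<Rightarrow> ('a list \<Rightarrow>\<^sub>0 int) set monoid" where
  "group_homology n G = bar_cycle_group n G Mod bar_boundaries n G"

definition bar_map :: "('a \<Rightarrow> 'b) \<Rightarrow> ('a list \<Rightarrow>\<^sub>0 int) \<Rightarrow> ('b list \<Rightarrow>\<^sub>0 int)" where
  "bar_map f = frag_extend (frag_of \<circ> map f)"

text \<open>
  A homology class is a coset of cycles. When \<open>f\<close> is a homomorphism, all cycles in one class
  are mapped into the same class of the target, so the union below is that single coset.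
\<close>

definition homology_map ::
    "nat \<Rightarrow> ('b, 'n) monoid_scheme \<Rightarrow> ('a \<Rightarrow> 'b) \<Rightarrow>
      ('a list \<Rightarrow>\<^sub>0 int) set \<Rightarrow> ('b list \<Rightarrow>\<^sub>0 int) set" where
  "homology_map n H f K = (\<Union>c\<in>K. bar_boundaries n H #>\<^bsub>bar_cycle_group n H\<^esub> bar_map f c)"

definition super_perfect :: "('a, 'm) monoid_scheme \<Rightarrow> bool" where
  "super_perfect Q \<longleftrightarrow>
     group Q \<and> trivial_group (group_homology 1 Q) \<and> trivial_group (group_homology 2 Q)"

definition homologically_2_connected ::
    "('a, 'm) monoid_scheme \<Rightarrow> ('b, 'n) monoid_scheme \<Rightarrow> ('a \<Rightarrow> 'b) \<Rightarrow> bool" where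
  "homologically_2_connected A B f \<longleftrightarrow>
     group A \<and> group B \<and> f \<in> hom A B \<and>
     homology_map 1 B f \<in> iso (group_homology 1 A) (group_homology 1 B) \<and>
     homology_map 2 B f \<in> epi (group_homology 2 A) (group_homology 2 B)"

section \<open>Free groups\<close>

text \<open>
  A letter \<open>(x, True)\<close> stands for \<open>x\<close> and \<open>(x, False)\<close> for its inverse. A group is free on \<open>S\<close> if
  every element is the value of exactly one reduced word over \<open>S\<close>.
\<close>

definition reduced_words :: "'a set \<Rightarrow> ('a \<times> bool) list set" where
  "reduced_words S = {w. fst ` set w \<subseteq> S \<and>
     (\<forall>i. Suc i < length w \<longrightarrow> \<not> (fst (w ! i) = fst (w ! Suc i) \<and> snd (w ! i) \<noteq> snd (w ! Suc i)))}"

definition word_value :: "('a, 'm) monoid_scheme \<Rightarrow> ('a \<times> bool) list \<Rightarrow> 'a" where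
  "word_value G w =
     foldr (\<lambda>(x, b) y. (if b then x else inv\<^bsub>G\<^esub> x) \<otimes>\<^bsub>G\<^esub> y) w \<one>\<^bsub>G\<^esub>"

definition free_on :: "('a, 'm) monoid_scheme \<Rightarrow> 'a set \<Rightarrow> bool" where
  "free_on G S \<longleftrightarrow> group G \<and> S \<subseteq> carrier G \<and>
     bij_betw (word_value G) (reduced_words S) (carrier G)"

definition free_group :: "('a, 'm) monoid_scheme \<Rightarrow> bool" where
  "free_group G \<longleftrightarrow> (\<exists>S. free_on G S)"

section \<open>Short exact sequences and fiber products\<close>

text \<open>
  The library's \<^const>\<open>short_exact_sequence\<close> forces all groups to have elements of the same type;
  this is the characterisation \<open>short_exact_sequence_iff\<close> without that restriction.
\<close>

definition group_extension ::
    "('r, 'k) monoid_scheme \<Rightarrow> ('r \<Rightarrow> 'f) \<Rightarrow> ('f, 'm) monoid_scheme \<Rightarrow> ('f \<Rightarrow> 'q) \<Rightarrow>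
      ('q, 'n) monoid_scheme \<Rightarrow> bool" where
  "group_extension R j F p Q \<longleftrightarrow> group R \<and> group F \<and> group Q \<and>
     j \<in> mon R F \<and> p \<in> epi F Q \<and> j ` carrier R = kernel F Q p"

definition fiber_product :: "('f, 'm) monoid_scheme \<Rightarrow> ('f \<Rightarrow> 'q) \<Rightarrow> ('f \<times> 'f) monoid" where
  "fiber_product F p =
     (F \<times>\<times> F)\<lparr>carrier := {(x, y). x \<in> carrier F \<and> y \<in> carrier F \<and> p x = p y}\<rparr>"

end

theory Submission
  imports Defs
begin

text \<open>
  Let \<open>P\<close> be the fiber product and \<open>K\<close> the kernel of \<open>p\<close>. The bar chains of \<open>Q\<close> are the cokernel of
  the difference of the two projections from the bar chains of \<open>P\<close> to those of \<open>F\<close>. A \<open>1\<close>-chain of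
  \<open>P\<close> with equal projections agrees with a diagonal chain up to the boundary of a chain which again has
  equal projections. Lifting to \<open>F\<close> a \<open>2\<close>-chain that bounds in \<open>Q\<close> thus shows that \<open>H\<^sub>2(Q) = 0\<close>
  makes \<open>H\<^sub>1(P) \<rightarrow> H\<^sub>1(F \<times> F)\<close> injective. Since \<open>Q\<close> is perfect, every element of \<open>F\<close> is homologous
  to an element of \<open>K\<close>; since \<open>F\<close> is free, \<open>H\<^sub>2(F \<times> F)\<close> is generated by cross products, which may
  therefore be taken between elements of \<open>K\<close> and so come from \<open>P\<close>.

  For the second claim, lift a \<open>3\<close>-cycle of \<open>Q\<close> to \<open>F\<close>. Its boundary is the difference of the
  projections of a \<open>2\<close>-cycle of \<open>P\<close>, which by injectivity of \<open>H\<^sub>2(P) \<rightarrow> H\<^sub>2(F \<times> F)\<close> is homologous to a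
  sum of cross products of elements of \<open>K\<close>. The projections of such cross products bound degenerate
  chains that are trivial over \<open>Q\<close>, so the lift can be corrected to a \<open>3\<close>-cycle of \<open>F\<close>, which bounds
  because \<open>F\<close> is free.
\<close>

section \<open>Linear maps on free abelian groups\<close>

definition frag_span :: "'a set \<Rightarrow> ('a \<Rightarrow>\<^sub>0 int) set" where
  "frag_span S = {c. Poly_Mapping.keys c \<subseteq> S}"

lemma frag_span_induct [consumes 1, case_names zero of diff]:
  assumes "c \<in> frag_span S" "P 0" "\<And>x. x \<in> S \<Longrightarrow> P (frag_of x)"
    "\<And>a b. a \<in> frag_span S \<Longrightarrow> b \<in> frag_span S \<Longrightarrow> P a \<Longrightarrow> P b \<Longrightarrow> P (a - b)"
  shows "P c"
  by (rule free_Abelian_group_induct [of c S]) (use assms in \<open>auto simp: frag_span_def\<close>)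

text \<open>Compatibility with differences already forces additivity, so both maps are determined on
  basis elements. The boundary formulas and homotopy identities below are thereby checked on a
  single tuple.\<close>

lemma frag_span_linear_eq:
  assumes "c \<in> frag_span S" "\<And>x. x \<in> S \<Longrightarrow> f (frag_of x) = g (frag_of x)"
    and f: "\<And>a b. f (a - b) = f a - f b" and g: "\<And>a b. g (a - b) = (g a - g b :: 'b :: ab_group_add)"
  shows "f c = g c"
  using assms(1)
proof (induction rule: frag_span_induct)
  case zero
  show ?case
    using f [of 0 0] g [of 0 0] by simp
qed (simp_all add: assms(2) f g)

lemma frag_span_zero [simp]: "0 \<in> frag_span S"
  and frag_span_of [simp]: "frag_of x \<in> frag_span S \<longleftrightarrow> x \<in> S"
  by (auto simp: frag_span_def)

lemma frag_span_diff: "a \<in> frag_span S \<Longrightarrow> b \<in> frag_span S \<Longrightarrow> a - b \<in> frag_span S"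
  unfolding frag_span_def using keys_diff by fastforce

lemma frag_span_add: "a \<in> frag_span S \<Longrightarrow> b \<in> frag_span S \<Longrightarrow> a + b \<in> frag_span S"
  unfolding frag_span_def using keys_add by fastforce

lemma frag_span_minus: "a \<in> frag_span S \<Longrightarrow> - a \<in> frag_span S"
  by (simp add: frag_span_def)

lemmas frag_span_arith = frag_span_diff frag_span_add frag_span_minus

lemma frag_span_extend:
  assumes "c \<in> frag_span S" "\<And>x. x \<in> S \<Longrightarrow> f x \<in> frag_span T"
  shows "frag_extend f c \<in> frag_span T"
  using assms(1)
  by (induction rule: frag_span_induct) (auto simp: frag_extend_diff assms(2) intro: frag_span_diff)

lemmas frag_extend_linear = frag_extend_diff frag_extend_add frag_extend_minus

lemma frag_extend_add_fun:
  "frag_extend (\<lambda>x. f x + g x) c = frag_extend f c + frag_extend g c"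
  by (simp add: frag_extend_def frag_cmul_distrib2 sum.distrib)

lemma frag_extend_minus_fun: "frag_extend (\<lambda>x. - f x) c = - frag_extend f c"
  by (induction c rule: frag_induction [OF subset_UNIV]) (simp_all add: frag_extend_diff)

lemma frag_extend_diff_fun:
  "frag_extend (\<lambda>x. f x - g x) c = frag_extend f c - frag_extend g c"
  using frag_extend_add_fun [of f "\<lambda>x. - g x" c] by (simp add: frag_extend_minus_fun)

definition frag_map :: "('a \<Rightarrow> 'b) \<Rightarrow> ('a \<Rightarrow>\<^sub>0 int) \<Rightarrow> ('b \<Rightarrow>\<^sub>0 int)" where
  "frag_map f = frag_extend (frag_of \<circ> f)"

lemma frag_map_zero [simp]: "frag_map f 0 = 0"
  and frag_map_of [simp]: "frag_map f (frag_of x) = frag_of (f x)"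
  by (simp_all add: frag_map_def)

lemma frag_map_diff: "frag_map f (a - b) = frag_map f a - frag_map f b"
  and frag_map_add: "frag_map f (a + b) = frag_map f a + frag_map f b"
  and frag_map_minus: "frag_map f (- a) = - frag_map f a"
  by (simp_all add: frag_map_def frag_extend_linear)

lemmas frag_linear = frag_extend_linear frag_map_diff frag_map_add frag_map_minus

lemma frag_map_compose: "frag_map f (frag_map g c) = frag_map (f \<circ> g) c"
  by (simp add: frag_map_def frag_extend_compose comp_assoc)

lemma frag_map_cong:
  assumes "c \<in> frag_span S" "\<And>x. x \<in> S \<Longrightarrow> f x = g x"
  shows "frag_map f c = frag_map g c"
  using assms(1) by (induction rule: frag_span_induct) (auto simp: assms(2) frag_linear)

lemma frag_map_id [simp]: "frag_map (\<lambda>x. x) c = c" "frag_map id c = c"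
  using frag_expansion [of c] by (simp_all add: frag_map_def comp_def)

lemma frag_map_span:
  assumes "c \<in> frag_span S" "\<And>x. x \<in> S \<Longrightarrow> f x \<in> T"
  shows "frag_map f c \<in> frag_span T"
  unfolding frag_map_def using assms by (intro frag_span_extend) auto

lemma frag_map_lift:
  assumes "c \<in> frag_span T" "T \<subseteq> f ` S"
  obtains d where "d \<in> frag_span S" "frag_map f d = c"
proof
  show "frag_map (inv_into S f) c \<in> frag_span S"
    using assms(1) by (rule frag_map_span) (use assms(2) in \<open>auto intro: inv_into_into\<close>)
  have "frag_map f (frag_map (inv_into S f) c) = frag_map (\<lambda>x. x) c"
    unfolding frag_map_compose
    using assms(1) by (rule frag_map_cong) (use assms(2) in \<open>auto simp: f_inv_into_f\<close>)
  then show "frag_map f (frag_map (inv_into S f) c) = c"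
    by simp
qed

text \<open>
  Degrees zero and one of the contractible Cech complex of a map \<open>f\<close>.
\<close>

lemma frag_map_kernel:
  assumes "c \<in> frag_span S" "frag_map f c = 0"
  obtains w where "w \<in> frag_span {(x, y). x \<in> S \<and> y \<in> S \<and> f x = f y}"
    "c = frag_map fst w - frag_map snd w"
proof
  define s where "s = inv_into S f \<circ> f"
  have s: "s x \<in> S" "f (s x) = f x" if "x \<in> S" for x
    using that by (auto simp: s_def inv_into_into f_inv_into_f)
  let ?w = "frag_map (\<lambda>x. (x, s x)) c"
  show "?w \<in> frag_span {(x, y). x \<in> S \<and> y \<in> S \<and> f x = f y}"
    using assms(1) by (rule frag_map_span) (auto simp: s)
  have "frag_map snd ?w = frag_map (inv_into S f) (frag_map f c)"
    by (simp add: frag_map_compose s_def comp_def)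
  then show "c = frag_map fst ?w - frag_map snd ?w"
    using assms(2) by (simp add: frag_map_compose comp_def)
qed

lemma frag_map_pair_kernel:
  assumes "w \<in> frag_span {(x, y). x \<in> S \<and> y \<in> S \<and> f x = f y}"
    and "frag_map fst w = frag_map snd w"
  obtains u where "u \<in> frag_span {(x, y, s). x \<in> S \<and> y \<in> S \<and> s \<in> S \<and> f x = f y \<and> f x = f s}"
    "frag_map (\<lambda>(x, y, s). (x, y)) u = w"
    "frag_map (\<lambda>(x, y, s). (x, s)) u = frag_map (\<lambda>(x, y, s). (y, s)) u"
proof
  define s where "s = inv_into S f \<circ> f"
  have s: "s x \<in> S" "f (s x) = f x" if "x \<in> S" for x
    using that by (auto simp: s_def inv_into_into f_inv_into_f)
  \<comment> \<open>Each pair is coned off to the chosen point \<open>s x\<close> of its fiber. That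
    point depends only on \<open>f x\<close>, hence is the same for both coordinates.\<close>
  let ?u = "frag_map (\<lambda>(x, y). (x, y, s x)) w"
  show "?u \<in> frag_span {(x, y, s). x \<in> S \<and> y \<in> S \<and> s \<in> S \<and> f x = f y \<and> f x = f s}"
    using assms(1) by (rule frag_map_span) (auto simp: s)
  have "frag_map (\<lambda>(x, y, s). (x, s)) ?u = frag_map (\<lambda>x. (x, s x)) (frag_map fst w)"
    by (simp add: frag_map_compose comp_def case_prod_beta)
  moreover have "frag_map (\<lambda>(x, y, s). (y, s)) ?u = frag_map (\<lambda>x. (x, s x)) (frag_map snd w)"
    unfolding frag_map_compose using assms(1) by (rule frag_map_cong) (auto simp: s_def)
  ultimately show "frag_map (\<lambda>(x, y, s). (x, s)) ?u = frag_map (\<lambda>(x, y, s). (y, s)) ?u"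
    using assms(2) by simp
  show "frag_map (\<lambda>(x, y, s). (x, y)) ?u = w"
    by (simp add: frag_map_compose comp_def case_prod_beta)
qed

section \<open>The bar complex\<close>

abbreviation bar_tuples :: "nat \<Rightarrow> ('a, 'm) monoid_scheme \<Rightarrow> 'a list set" where
  "bar_tuples n G \<equiv> {gs. length gs = n \<and> set gs \<subseteq> carrier G}"

abbreviation bar_chains :: "nat \<Rightarrow> ('a, 'm) monoid_scheme \<Rightarrow> ('a list \<Rightarrow>\<^sub>0 int) set" where
  "bar_chains n G \<equiv> frag_span (bar_tuples n G)"

lemma carrier_bar_chain_group [simp]: "carrier (bar_chain_group n G) = bar_chains n G"
  by (simp add: set_eq_iff bar_chain_group_def frag_span_def)

lemma bar_boundary_linear:
  "bar_boundary G (a - b) = bar_boundary G a - bar_boundary G b"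
  "bar_boundary G (a + b) = bar_boundary G a + bar_boundary G b"
  "bar_boundary G (- a) = - bar_boundary G a"
  "bar_boundary G 0 = 0"
  by (simp_all add: bar_boundary_def frag_extend_linear)

lemma bar_boundary_Nil [simp]: "bar_boundary G (frag_of []) = 0"
  by (simp add: bar_boundary_def)

lemma bar_boundary_single [simp]: "bar_boundary G (frag_of [x]) = 0"
  by (simp add: bar_boundary_def bar_face_def)

abbreviation frag_cons :: "'a \<Rightarrow> ('a list \<Rightarrow>\<^sub>0 int) \<Rightarrow> ('a list \<Rightarrow>\<^sub>0 int)" where
  "frag_cons x \<equiv> frag_map ((#) x)"

lemma frag_map_sum_cmul:
  "frag_map f (\<Sum>i\<in>I. frag_cmul (k i) (c i)) = (\<Sum>i\<in>I. frag_cmul (k i) (frag_map f (c i)))"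
  by (induction I rule: infinite_finite_induct)
     (auto simp: frag_map_def frag_extend_add frag_extend_cmul)

text \<open>Every face of index at least two keeps \<open>x\<close> and applies to
  \<open>y # r\<close> the face of index one lower. Prepending \<open>x\<close> to the whole
  boundary of \<open>y # r\<close> also brings in its zeroth face, which the last summand
  \<open>x # r\<close> compensates.\<close>

lemma bar_boundary_Cons_Cons:
  "bar_boundary G (frag_of (x # y # r)) = frag_of (y # r) - frag_of ((x \<otimes>\<^bsub>G\<^esub> y) # r)
     - frag_cons x (bar_boundary G (frag_of (y # r))) + frag_of (x # r)"
proof -
  let ?m = "length r"
  \<comment> \<open>The faces of \<open>y # r\<close> of positive index, with all signs
    reversed.\<close>
  define A where "A = (\<Sum>i\<le>?m. frag_cmul ((-1) ^ i) (frag_of (bar_face G (Suc i) (y # r))))"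
  have face: "bar_face G (Suc (Suc i)) (x # y # r) = x # bar_face G (Suc i) (y # r)" for i
    by (auto simp: bar_face_def)
  have f0: "bar_face G 0 (x # y # r) = y # r" "bar_face G 0 (y # r) = r"
    "bar_face G (Suc 0) (x # y # r) = (x \<otimes>\<^bsub>G\<^esub> y) # r"
    by (simp_all add: bar_face_def)
  have 1: "bar_boundary G (frag_of (y # r)) = frag_of r - A"
    unfolding A_def bar_boundary_def
    by (simp add: sum.atMost_Suc_shift f0 sum_negf flip: minus_frag_cmul del: sum.atMost_Suc)
  have "bar_boundary G (frag_of (x # y # r)) = frag_of (y # r) - frag_of ((x \<otimes>\<^bsub>G\<^esub> y) # r)
      + (\<Sum>i\<le>?m. frag_cmul ((-1) ^ i) (frag_of (x # bar_face G (Suc i) (y # r))))"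
    unfolding bar_boundary_def
    by (simp add: sum.atMost_Suc_shift f0 face del: sum.atMost_Suc)
  also have "(\<Sum>i\<le>?m. frag_cmul ((-1) ^ i) (frag_of (x # bar_face G (Suc i) (y # r)))) = frag_cons x A"
    by (simp add: A_def frag_map_sum_cmul)
  finally show ?thesis
    by (simp add: 1 frag_linear)
qed

lemmas bar_linear = frag_linear bar_boundary_linear

lemma frag_span_boundary_tuple:
  assumes "group G" "gs \<in> bar_tuples (Suc n) G"
  shows "bar_boundary G (frag_of gs) \<in> bar_chains n G"
  using assms(2)
proof (induction gs arbitrary: n)
  case (Cons x gs)
  interpret group G by fact
  show ?case
  proof (cases gs)
    case (Cons y r)
    then obtain m where m: "n = Suc m"
      using Cons.prems by (cases n) auto
    have "bar_boundary G (frag_of gs) \<in> bar_chains m G"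
      using Cons.IH [of m] Cons.prems m by auto
    then have "frag_cons x (bar_boundary G (frag_of gs)) \<in> bar_chains n G"
      by (rule frag_map_span) (use Cons.prems m in auto)
    then show ?thesis
      using Cons.prems Cons by (auto simp: bar_boundary_Cons_Cons intro!: frag_span_arith)
  qed auto
qed auto

lemma bar_boundary_chain:
  assumes "group G" "c \<in> bar_chains (Suc n) G"
  shows "bar_boundary G c \<in> bar_chains n G"
  using assms(2) by (induction rule: frag_span_induct)
    (auto simp: bar_boundary_linear intro!: frag_span_diff frag_span_boundary_tuple [OF assms(1)])

text \<open>Linear form of the recursion, for \<open>x\<close> put in front of a whole chain.
  Nonempty lists are required because \<open>x\<close> has to multiply a head.\<close>

lemma bar_boundary_frag_cons:
  assumes "c \<in> frag_span {gs. gs \<noteq> []}"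
  shows "bar_boundary G (frag_cons x c) = c - frag_map (\<lambda>l. (x \<otimes>\<^bsub>G\<^esub> hd l) # tl l) c
    - frag_cons x (bar_boundary G c) + frag_map (\<lambda>l. x # tl l) c"
  using assms
proof (induction rule: frag_span_induct)
  case (of l)
  then show ?case
    by (cases l) (auto simp: bar_boundary_Cons_Cons)
qed (simp_all add: bar_linear)

text \<open>Applying the recursion twice leaves \<open>x\<close> in front of the double boundary of
  the tail, which vanishes by induction; the remaining terms cancel by associativity.\<close>

lemma bar_boundary_boundary_tuple:
  assumes "group G" "set gs \<subseteq> carrier G"
  shows "bar_boundary G (bar_boundary G (frag_of gs)) = 0"
  using assms(2)
proof (induction gs)
  case (Cons x gs)
  interpret group G by fact
  note IH = Cons.IH
  consider "gs = []" | y where "gs = [y]" | y z r where "gs = y # z # r"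
    by (metis neq_Nil_conv)
  then show ?case
  proof cases
    case 3
    have "bar_boundary G (frag_of gs) \<in> bar_chains (length gs - 1) G"
      by (rule frag_span_boundary_tuple) (use Cons.prems 3 in \<open>auto intro: \<open>group G\<close>\<close>)
    then have ne: "bar_boundary G (frag_of gs) \<in> frag_span {gs. gs \<noteq> []}"
      using 3 by (auto simp: frag_span_def)
    show ?thesis
      using Cons.prems IH
      by (simp add: 3 bar_boundary_Cons_Cons [of G x] bar_linear bar_boundary_frag_cons [OF ne [unfolded 3]])
         (simp add: bar_boundary_Cons_Cons bar_linear frag_map_compose comp_def m_assoc)
  qed (auto simp: bar_boundary_Cons_Cons bar_linear)
qed (simp add: bar_linear)

lemma bar_boundary_boundary:
  assumes "group G" "c \<in> bar_chains n G"
  shows "bar_boundary G (bar_boundary G c) = 0"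
  using assms(2) by (induction rule: frag_span_induct)
    (auto simp: bar_boundary_linear bar_boundary_boundary_tuple [OF assms(1)])

section \<open>Chain maps induced by homomorphisms\<close>

lemma bar_map_eq_frag_map: "bar_map f = frag_map (map f)"
  by (simp add: bar_map_def frag_map_def)

lemmas bar_map_linear = frag_map_diff [of "map f" for f, folded bar_map_eq_frag_map]
  frag_map_add [of "map f" for f, folded bar_map_eq_frag_map]
  frag_map_minus [of "map f" for f, folded bar_map_eq_frag_map]
  frag_map_zero [of "map f" for f, folded bar_map_eq_frag_map]

lemma bar_map_of [simp]: "bar_map f (frag_of gs) = frag_of (map f gs)"
  by (simp add: bar_map_eq_frag_map)

lemma bar_map_chain:
  assumes "f \<in> carrier G \<rightarrow> carrier H" "c \<in> bar_chains n G"
  shows "bar_map f c \<in> bar_chains n H"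
  unfolding bar_map_eq_frag_map using assms(2) by (rule frag_map_span) (use assms(1) in auto)

lemma bar_boundary_map:
  assumes "f \<in> hom G H" "c \<in> bar_chains n G"
  shows "bar_boundary H (bar_map f c) = bar_map f (bar_boundary G c)"
proof -
  have "bar_boundary H (frag_of (map f gs)) = bar_map f (bar_boundary G (frag_of gs))"
    if "set gs \<subseteq> carrier G" for gs
    using that
  proof (induction gs)
    case (Cons x gs)
    show ?case
    proof (cases gs)
      case (Cons y r)
      with Cons.IH Cons.prems have "frag_cons (f x) (bar_boundary H (frag_of (f y # map f r)))
          = bar_map f (frag_cons x (bar_boundary G (frag_of gs)))"
        by (simp add: bar_map_eq_frag_map frag_map_compose comp_def)
      then show ?thesis
        using Cons Cons.prems hom_mult [OF assms(1)]
        by (simp add: bar_boundary_Cons_Cons bar_map_linear)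
    qed (simp add: bar_map_linear)
  qed (simp add: bar_map_linear)
  with assms(2) show ?thesis
    by (induction rule: frag_span_induct) (auto simp: bar_map_linear bar_boundary_linear)
qed

section \<open>Subgroups of boundaries and cycles\<close>

lemma bar_boundaries_eq: "bar_boundaries n G = bar_boundary G ` bar_chains (Suc n) G"
  by (simp add: bar_boundaries_def)

lemma bar_boundariesI: "c \<in> bar_chains (Suc n) G \<Longrightarrow> bar_boundary G c \<in> bar_boundaries n G"
  by (simp add: bar_boundaries_eq)

lemma bar_boundaries_zero [simp]: "0 \<in> bar_boundaries n G"
  using bar_boundariesI [of 0 n G] by (simp add: bar_boundary_linear)

lemma bar_boundaries_diff:
  "\<lbrakk>a \<in> bar_boundaries n G; b \<in> bar_boundaries n G\<rbrakk> \<Longrightarrow> a - b \<in> bar_boundaries n G"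
  unfolding bar_boundaries_eq
  by (auto simp flip: bar_boundary_linear(1) intro!: imageI frag_span_diff)

lemma bar_boundaries_minus: "a \<in> bar_boundaries n G \<Longrightarrow> - a \<in> bar_boundaries n G"
  using bar_boundaries_diff [of 0 n G a] by simp

lemma bar_boundaries_add:
  "\<lbrakk>a \<in> bar_boundaries n G; b \<in> bar_boundaries n G\<rbrakk> \<Longrightarrow> a + b \<in> bar_boundaries n G"
  using bar_boundaries_diff [of a n G "- b"] by (simp add: bar_boundaries_minus)

lemmas bar_boundaries_arith = bar_boundaries_diff bar_boundaries_add bar_boundaries_minus

lemma bar_boundaries_map:
  assumes "f \<in> hom G H" "c \<in> bar_boundaries n G"
  shows "bar_map f c \<in> bar_boundaries n H"
proof -
  obtain d where "d \<in> bar_chains (Suc n) G" "c = bar_boundary G d"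
    using assms(2) by (auto simp: bar_boundaries_eq)
  then show ?thesis
    using assms(1) bar_boundariesI [OF bar_map_chain [of f G H d "Suc n"]]
    by (auto simp: hom_def bar_boundary_map [OF assms(1)])
qed

text \<open>Cycles as a plain set of chains. They already form a subgroup, so this is the carrier of
  \<open>bar_cycle_group\<close>, and computations can use ordinary \<open>+\<close> and
  \<open>-\<close>.\<close>

definition bar_cycles :: "nat \<Rightarrow> ('a, 'm) monoid_scheme \<Rightarrow> ('a list \<Rightarrow>\<^sub>0 int) set" where
  "bar_cycles n G = {c \<in> bar_chains n G. bar_boundary G c = 0}"

lemma bar_cycles_diff: "\<lbrakk>a \<in> bar_cycles n G; b \<in> bar_cycles n G\<rbrakk> \<Longrightarrow> a - b \<in> bar_cycles n G"
  by (simp add: bar_cycles_def frag_span_diff bar_boundary_linear)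

lemma bar_cycles_map:
  assumes "f \<in> hom G H" "c \<in> bar_cycles n G"
  shows "bar_map f c \<in> bar_cycles n H"
  using assms bar_map_chain [of f G H c n]
  by (auto simp: hom_def bar_cycles_def bar_boundary_map [OF assms(1)] bar_map_linear)

lemma bar_boundaries_subset_cycles:
  assumes "group G"
  shows "bar_boundaries n G \<subseteq> bar_cycles n G"
  using assms by (auto simp: bar_boundaries_eq bar_cycles_def bar_boundary_chain bar_boundary_boundary)

lemma bar_cycles_1: "bar_cycles 1 G = bar_chains 1 G"
proof -
  have "bar_boundary G c = 0" if "c \<in> bar_chains 1 G" for c
    using that by (induction rule: frag_span_induct) (auto simp: bar_boundary_linear length_Suc_conv)
  then show ?thesis
    by (auto simp: bar_cycles_def)
qed

subsection \<open>Homology classes and representing cycles\<close>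

lemma group_bar_chain_group: "group (bar_chain_group n G)"
  and comm_group_bar_chain_group: "comm_group (bar_chain_group n G)"
  and mult_bar_chain_group: "a \<otimes>\<^bsub>bar_chain_group n G\<^esub> b = a + b"
  and one_bar_chain_group: "\<one>\<^bsub>bar_chain_group n G\<^esub> = 0"
  by (simp_all add: bar_chain_group_def abelian_free_Abelian_group)

lemma inv_bar_chain_group:
  "c \<in> bar_chains n G \<Longrightarrow> inv\<^bsub>bar_chain_group n G\<^esub> c = - c"
  by (simp add: bar_chain_group_def frag_span_def)

lemma subgroup_bar_cycles: "subgroup (bar_cycles n G) (bar_chain_group n G)"
proof (rule group.subgroupI [OF group_bar_chain_group])
  show "bar_cycles n G \<noteq> {}"
    by (auto simp: bar_cycles_def bar_boundary_linear intro!: exI [of _ 0])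
qed (auto simp: bar_cycles_def inv_bar_chain_group mult_bar_chain_group bar_boundary_linear
      intro: frag_span_arith)

lemma carrier_bar_cycle_group [simp]: "carrier (bar_cycle_group n G) = bar_cycles n G"
  unfolding bar_cycle_group_def
  using subgroup.carrier_subgroup_generated_subgroup [OF subgroup_bar_cycles]
  by (simp add: bar_cycles_def)

lemma mult_bar_cycle_group [simp]: "a \<otimes>\<^bsub>bar_cycle_group n G\<^esub> b = a + b"
  and one_bar_cycle_group [simp]: "\<one>\<^bsub>bar_cycle_group n G\<^esub> = 0"
  by (simp_all add: bar_cycle_group_def mult_bar_chain_group one_bar_chain_group)

lemma comm_group_bar_cycle_group: "comm_group (bar_cycle_group n G)"
  unfolding bar_cycle_group_def
  by (rule group.abelian_subgroup_generated [OF group_bar_chain_group comm_group_bar_chain_group])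

lemma inv_bar_cycle_group [simp]:
  assumes "c \<in> bar_cycles n G"
  shows "inv\<^bsub>bar_cycle_group n G\<^esub> c = - c"
proof -
  have "- c \<in> bar_cycles n G"
    using assms by (auto simp: bar_cycles_def bar_boundary_linear intro: frag_span_minus)
  then show ?thesis
    using assms comm_group.axioms(2) [OF comm_group_bar_cycle_group, of n G]
    by (intro group.inv_equality) auto
qed

lemma normal_bar_boundaries:
  assumes "group G"
  shows "bar_boundaries n G \<lhd> bar_cycle_group n G"
proof (rule comm_group.subgroup_imp_normal [OF comm_group_bar_cycle_group])
  note sub = bar_boundaries_subset_cycles [OF assms, of n]
  show "subgroup (bar_boundaries n G) (bar_cycle_group n G)"
  proof (rule group.subgroupI [OF comm_group.axioms(2) [OF comm_group_bar_cycle_group]])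
    show "bar_boundaries n G \<noteq> {}"
      using bar_boundaries_zero by blast
  qed (use sub in \<open>simp_all add: subset_iff bar_boundaries_add bar_boundaries_minus\<close>)
qed

abbreviation homology_class :: "nat \<Rightarrow> ('a, 'm) monoid_scheme \<Rightarrow> ('a list \<Rightarrow>\<^sub>0 int) \<Rightarrow> ('a list \<Rightarrow>\<^sub>0 int) set" where
  "homology_class n G c \<equiv> bar_boundaries n G #>\<^bsub>bar_cycle_group n G\<^esub> c"

lemma group_group_homology: "group G \<Longrightarrow> group (group_homology n G)"
  unfolding group_homology_def by (intro normal.factorgroup_is_group normal_bar_boundaries)

lemma carrier_group_homology: "carrier (group_homology n G) = homology_class n G ` bar_cycles n G"
  by (simp add: group_homology_def carrier_FactGroup)

lemma one_group_homology: "\<one>\<^bsub>group_homology n G\<^esub> = bar_boundaries n G"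
  by (simp add: group_homology_def)

lemma homology_class_iff: "x \<in> homology_class n G c \<longleftrightarrow> x - c \<in> bar_boundaries n G"
proof
  assume "x - c \<in> bar_boundaries n G"
  then show "x \<in> homology_class n G c"
    unfolding r_coset_def by (intro UN_I [of "x - c"]) auto
qed (auto simp: r_coset_def)

lemma homology_class_eq_iff:
  "homology_class n G a = homology_class n G b \<longleftrightarrow> a - b \<in> bar_boundaries n G"
proof
  assume "homology_class n G a = homology_class n G b"
  moreover have "a \<in> homology_class n G a"
    by (simp add: homology_class_iff)
  ultimately show "a - b \<in> bar_boundaries n G"
    by (simp add: homology_class_iff)
next
  assume *: "a - b \<in> bar_boundaries n G"
  have "x - a \<in> bar_boundaries n G \<longleftrightarrow> x - b \<in> bar_boundaries n G" for x
    using bar_boundaries_add [of "x - a" n G "a - b"] bar_boundaries_diff [of "x - b" n G "a - b"] *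
    by auto
  then show "homology_class n G a = homology_class n G b"
    by (auto simp: set_eq_iff homology_class_iff)
qed

lemma homology_class_zero: "homology_class n G 0 = bar_boundaries n G"
  by (auto simp: set_eq_iff homology_class_iff)

lemma homology_class_eq_one_iff:
  "homology_class n G c = \<one>\<^bsub>group_homology n G\<^esub> \<longleftrightarrow> c \<in> bar_boundaries n G"
  using homology_class_eq_iff [of n G c 0] by (simp add: one_group_homology homology_class_zero)

lemma mult_group_homology:
  assumes "group G" "a \<in> bar_cycles n G" "b \<in> bar_cycles n G"
  shows "homology_class n G a \<otimes>\<^bsub>group_homology n G\<^esub> homology_class n G b = homology_class n G (a + b)"
  using normal.rcos_sum [OF normal_bar_boundaries [OF assms(1)], of a n b] assms
  by (simp add: group_homology_def)

text \<open>A class is trivial exactly when its cycle bounds. Vanishing of homology is used below in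
  this chain-level form.\<close>

lemma trivial_group_homology_iff:
  assumes "group G"
  shows "trivial_group (group_homology n G) \<longleftrightarrow> bar_cycles n G \<subseteq> bar_boundaries n G"
proof -
  have "trivial_group (group_homology n G)
      \<longleftrightarrow> carrier (group_homology n G) \<subseteq> {\<one>\<^bsub>group_homology n G\<^esub>}"
    by (rule group.trivial_group_subset [OF group_group_homology [OF assms]])
  then show ?thesis
    by (simp only: carrier_group_homology image_subset_iff homology_class_eq_one_iff singleton_iff) blast
qed

lemma homology_map_class:
  assumes "f \<in> hom G H"
  shows "homology_map n H f (homology_class n G c) = homology_class n H (bar_map f c)"
proof -
  have "homology_class n H (bar_map f x) = homology_class n H (bar_map f c)"
    if "x \<in> homology_class n G c" for x
    using that bar_boundaries_map [OF assms, of "x - c" n]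
    by (simp add: homology_class_iff homology_class_eq_iff bar_map_linear)
  moreover have "c \<in> homology_class n G c"
    by (simp add: homology_class_iff)
  ultimately show ?thesis
    unfolding homology_map_def by blast
qed

lemma homology_map_hom:
  assumes "group G" "group H" "f \<in> hom G H"
  shows "homology_map n H f \<in> hom (group_homology n G) (group_homology n H)"
proof (rule homI)
  note cycles_map = bar_cycles_map [OF assms(3)]
  show "homology_map n H f x \<in> carrier (group_homology n H)"
    if "x \<in> carrier (group_homology n G)" for x
    using that by (auto simp: carrier_group_homology homology_map_class [OF assms(3)] cycles_map)
  have sum: "a + b \<in> bar_cycles n G" if "a \<in> bar_cycles n G" "b \<in> bar_cycles n G" for a b
    using that by (auto simp: bar_cycles_def bar_boundary_linear intro: frag_span_add)
  show "homology_map n H f (x \<otimes>\<^bsub>group_homology n G\<^esub> y)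
      = homology_map n H f x \<otimes>\<^bsub>group_homology n H\<^esub> homology_map n H f y"
    if "x \<in> carrier (group_homology n G)" "y \<in> carrier (group_homology n G)" for x y
    using that assms sum
    by (auto simp: carrier_group_homology mult_group_homology homology_map_class
        cycles_map bar_map_linear)
qed

lemma homology_map_epi:
  assumes "group G" "group H" "f \<in> hom G H"
    and "\<And>c. c \<in> bar_cycles n H \<Longrightarrow> \<exists>d \<in> bar_cycles n G. c - bar_map f d \<in> bar_boundaries n H"
  shows "homology_map n H f \<in> epi (group_homology n G) (group_homology n H)"
proof -
  note hom = homology_map_hom [OF assms(1-3), of n]
  have "x \<in> homology_map n H f ` carrier (group_homology n G)"
    if "x \<in> carrier (group_homology n H)" for x
  proof -
    obtain c where c: "c \<in> bar_cycles n H" "x = homology_class n H c"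
      using \<open>x \<in> carrier (group_homology n H)\<close> by (auto simp: carrier_group_homology)
    obtain d where "d \<in> bar_cycles n G" "c - bar_map f d \<in> bar_boundaries n H"
      using assms(4) [OF c(1)] by blast
    then have "x = homology_map n H f (homology_class n G d)"
      by (simp add: c(2) homology_map_class [OF assms(3)] homology_class_eq_iff)
    with \<open>d \<in> bar_cycles n G\<close> show ?thesis
      by (simp add: carrier_group_homology)
  qed
  with hom show ?thesis
    by (auto simp: epi_def hom_def)
qed

lemma homology_map_iso:
  assumes "group G" "group H" "f \<in> hom G H"
    and "\<And>c. c \<in> bar_cycles n H \<Longrightarrow> \<exists>d \<in> bar_cycles n G. c - bar_map f d \<in> bar_boundaries n H"
    and "\<And>c. c \<in> bar_cycles n G \<Longrightarrow> bar_map f c \<in> bar_boundaries n H \<Longrightarrow> c \<in> bar_boundaries n G"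
  shows "homology_map n H f \<in> iso (group_homology n G) (group_homology n H)"
proof -
  have "inj_on (homology_map n H f) (carrier (group_homology n G))"
  proof (rule inj_onI)
    fix x y
    assume xy: "x \<in> carrier (group_homology n G)" "y \<in> carrier (group_homology n G)"
      "homology_map n H f x = homology_map n H f y"
    then obtain a b where ab: "a \<in> bar_cycles n G" "x = homology_class n G a"
      "b \<in> bar_cycles n G" "y = homology_class n G b"
      by (auto simp: carrier_group_homology)
    then show "x = y"
      using xy(3) assms(5) [of "a - b"]
      by (simp add: homology_map_class [OF assms(3)] homology_class_eq_iff bar_cycles_diff bar_map_linear)
  qed
  with homology_map_epi [OF assms(1-4)] show ?thesis
    by (simp add: epi_def iso_def bij_betw_def)
qed

lemma homology_map_kernel_trivialD:
  assumes "f \<in> hom G H"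
    and "kernel (group_homology n G) (group_homology n H) (homology_map n H f)
      = {\<one>\<^bsub>group_homology n G\<^esub>}"
    and "c \<in> bar_cycles n G" "bar_map f c \<in> bar_boundaries n H"
  shows "c \<in> bar_boundaries n G"
proof -
  have "homology_class n G c \<in> kernel (group_homology n G) (group_homology n H) (homology_map n H f)"
    using assms(3,4)
    by (simp add: kernel_def carrier_group_homology homology_map_class [OF assms(1)]
        homology_class_eq_one_iff)
  then show ?thesis
    using assms(2) by (simp add: homology_class_eq_one_iff)
qed

section \<open>Acyclicity of free groups\<close>

text \<open>
  The list \<open>[x, w]\<close> stands for \<open>w\<close> in the coordinate of the generator \<open>x\<close> of the free module
  over the group ring, so that the two clauses are \<open>D(x w) = [x, w] + D w\<close> and
  \<open>D(x\<inverse> w) = - [x, x\<inverse> w] + D w\<close>.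
\<close>

primrec word_fox :: "('a, 'm) monoid_scheme \<Rightarrow> ('a \<times> bool) list \<Rightarrow> ('a list \<Rightarrow>\<^sub>0 int)" where
  "word_fox G [] = 0"
| "word_fox G (l # w) = word_fox G w +
     (if snd l then frag_of [fst l, word_value G w]
      else - frag_of [fst l, inv\<^bsub>G\<^esub> (fst l) \<otimes>\<^bsub>G\<^esub> word_value G w])"

text \<open>The Fox derivative becomes a function on the group through the unique reduced word of
  \<open>g\<close>, which exists when \<open>G\<close> is free on \<open>S\<close>.\<close>

definition fox :: "('a, 'm) monoid_scheme \<Rightarrow> 'a set \<Rightarrow> 'a \<Rightarrow> ('a list \<Rightarrow>\<^sub>0 int)" where
  "fox G S g = word_fox G (inv_into (reduced_words S) (word_value G) g)"

lemma word_value_Nil [simp]: "word_value G [] = \<one>\<^bsub>G\<^esub>"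
  and word_value_Cons [simp]: "word_value G (l # w) =
    (if snd l then fst l else inv\<^bsub>G\<^esub> (fst l)) \<otimes>\<^bsub>G\<^esub> word_value G w"
  by (simp_all add: word_value_def case_prod_beta)

lemma reduced_words_Cons:
  "l # w \<in> reduced_words S \<longleftrightarrow> fst l \<in> S \<and> w \<in> reduced_words S \<and>
     (w = [] \<or> \<not> (fst l = fst (hd w) \<and> snd l \<noteq> snd (hd w)))"
proof (cases w)
  case (Cons l' w')
  have "(\<forall>i. Suc i < length (l # w) \<longrightarrow> P ((l # w) ! i) ((l # w) ! Suc i))
    \<longleftrightarrow> P l l' \<and> (\<forall>i. Suc i < length w \<longrightarrow> P (w ! i) (w ! Suc i))" for P
    unfolding Cons by (auto simp: all_conj_distrib nth_Cons split: nat.splits)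
  from this [of "\<lambda>a b. \<not> (fst a = fst b \<and> snd a \<noteq> snd b)"]
  show ?thesis
    by (auto simp: reduced_words_def Cons)
qed (simp add: reduced_words_def)

context group
begin

lemma word_value_closed:
  "fst ` set w \<subseteq> carrier G \<Longrightarrow> word_value G w \<in> carrier G"
  by (induction w) auto

lemma word_value_append:
  "\<lbrakk>fst ` set v \<subseteq> carrier G; fst ` set w \<subseteq> carrier G\<rbrakk>
    \<Longrightarrow> word_value G (v @ w) = word_value G v \<otimes> word_value G w"
  by (induction v) (auto simp: word_value_closed m_assoc)

text \<open>Cancelling adjacent inverse letters preserves the value of a word, and it preserves the
  derivative because the two letters contribute the same pair with opposite signs. So every word may
  be used in place of the reduced one.\<close>

lemma fox_word_value:
  assumes free: "free_on G S" and w: "fst ` set w \<subseteq> S"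
  shows "fox G S (word_value G w) = word_fox G w"
proof -
  have S: "S \<subseteq> carrier G" and bij: "bij_betw (word_value G) (reduced_words S) (carrier G)"
    using free by (auto simp: free_on_def)
  have reduced: "fox G S (word_value G u) = word_fox G u" if "u \<in> reduced_words S" for u
    using that bij by (simp add: fox_def bij_betw_def)
  have closed: "word_value G v \<in> carrier G" if "fst ` set v \<subseteq> S" for v
    using that S by (intro word_value_closed) auto
  show ?thesis
    using w
  proof (induction w)
    case Nil
    then show ?case
      using reduced [of "[]"] by (simp add: reduced_words_def)
  next
    case (Cons l w)
    have l: "fst l \<in> S" "fst l \<in> carrier G"
      using Cons.prems S by auto
    \<comment> \<open>The tail is replaced by its reduced form. Prepending \<open>l\<close> to that
      either stays reduced or cancels its first letter.\<close>
    obtain u where u: "u \<in> reduced_words S" "word_value G u = word_value G w"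
      using closed [of w] Cons.prems unfolding bij_betw_imp_surj_on [OF bij, symmetric] by auto
    then have wu: "word_fox G w = word_fox G u"
      using reduced [of u] Cons.IH Cons.prems by auto
    show ?case
    proof (cases "l # u \<in> reduced_words S")
      case True
      from reduced [OF this] show ?thesis
        using u wu by simp
    next
      case False
      then obtain l' u' where lu': "u = l' # u'" "fst l = fst l'" "snd l \<noteq> snd l'"
        using u(1) l by (cases u) (auto simp: reduced_words_Cons)
      have u': "u' \<in> reduced_words S" "word_value G u' \<in> carrier G"
        using u(1) closed [of u'] unfolding lu' reduced_words_Cons by (auto simp: reduced_words_def)
      have val: "word_value G (l # w) = word_value G u'"
        using lu' l u' by (cases "snd l") (simp_all add: u(2) [symmetric] flip: m_assoc)
      have "word_fox G (l # w) = word_fox G u'"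
        using lu' l u' by (cases "snd l") (simp_all add: wu u(2) [symmetric] flip: m_assoc)
      then show ?thesis
        using reduced [OF u'(1)] val by simp
    qed
  qed
qed

lemma free_on_word:
  assumes "free_on G S" "g \<in> carrier G"
  obtains w where "fst ` set w \<subseteq> S" "word_value G w = g"
proof -
  have "g \<in> word_value G ` reduced_words S"
    using assms by (simp add: free_on_def bij_betw_def)
  then show ?thesis
    using that by (auto simp: reduced_words_def)
qed

lemma fox_span:
  assumes "free_on G S" "g \<in> carrier G"
  shows "fox G S g \<in> frag_span {[x, w] | x w. x \<in> carrier G \<and> w \<in> carrier G}"
proof -
  obtain w where w: "fst ` set w \<subseteq> S" "word_value G w = g"
    using assms by (rule free_on_word)
  have S: "S \<subseteq> carrier G"
    using assms by (simp add: free_on_def)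
  have "word_fox G w \<in> frag_span {[x, w] | x w. x \<in> carrier G \<and> w \<in> carrier G}"
    using w(1)
  proof (induction w)
    case (Cons l w)
    then have "fst l \<in> carrier G" "word_value G w \<in> carrier G"
      using S by (auto intro!: word_value_closed)
    then show ?case
      using Cons by (auto intro!: frag_span_arith)
  qed auto
  then show ?thesis
    using fox_word_value [OF assms(1) w(1)] w(2) by simp
qed

text \<open>Concatenating words for \<open>g\<close> and \<open>h\<close> gives the product rule D(g
  h) = D(g) h + D(h) of Fox calculus, where \<open>h\<close> multiplies the group entry of each pair
  from the right.\<close>

lemma fox_mult:
  assumes "free_on G S" "g \<in> carrier G" "h \<in> carrier G"
  shows "fox G S (g \<otimes> h) = frag_map (\<lambda>l. [l ! 0, l ! 1 \<otimes> h]) (fox G S g) + fox G S h"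
proof -
  obtain u where u: "fst ` set u \<subseteq> S" "word_value G u = g"
    using assms(1,2) by (rule free_on_word)
  obtain v where v: "fst ` set v \<subseteq> S" "word_value G v = h"
    using assms(1,3) by (rule free_on_word)
  have S: "S \<subseteq> carrier G"
    using assms by (simp add: free_on_def)
  have vS: "fst ` set v \<subseteq> carrier G"
    using v S by auto
  have "word_fox G (u @ v) = frag_map (\<lambda>l. [l ! 0, l ! 1 \<otimes> h]) (word_fox G u) + word_fox G v"
    using u(1)
  proof (induction u)
    case (Cons l u)
    then have c: "fst l \<in> carrier G" "fst ` set u \<subseteq> carrier G" "word_value G u \<in> carrier G"
      using S by (auto intro!: word_value_closed)
    have "word_value G (u @ v) = word_value G u \<otimes> h"
      using c(2) vS v(2) by (simp add: word_value_append)
    moreover have "fst ` set u \<subseteq> S"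
      using Cons.prems by simp
    ultimately show ?case
      using c assms(3) by (simp add: Cons.IH frag_linear m_assoc)
  qed simp
  moreover have "word_value G (u @ v) = g \<otimes> h"
    using u v S vS by (subst word_value_append) auto
  moreover have "fst ` set (u @ v) \<subseteq> S"
    using u(1) v(1) by (simp add: image_Un)
  ultimately show ?thesis
    using fox_word_value [OF assms(1), of "u @ v"] fox_word_value [OF assms(1) u(1)]
      fox_word_value [OF assms(1) v(1)] by (simp add: u(2) v(2))
qed

end

section \<open>The homotopy given by the Fox derivative\<close>

lemma frag_extend_map: "frag_extend f (frag_map g c) = frag_extend (f \<circ> g) c"
  by (simp add: frag_map_def frag_extend_compose)

definition frag_append :: "('a list \<Rightarrow>\<^sub>0 int) \<Rightarrow> ('a list \<Rightarrow>\<^sub>0 int) \<Rightarrow> ('a list \<Rightarrow>\<^sub>0 int)" where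
  "frag_append d = frag_extend (\<lambda>r. frag_map (\<lambda>l. l @ r) d)"

lemma frag_append_of [simp]: "frag_append d (frag_of r) = frag_map (\<lambda>l. l @ r) d"
  by (simp add: frag_append_def)

lemma frag_append_linear:
  "frag_append (d - e) c = frag_append d c - frag_append e c"
  "frag_append (d + e) c = frag_append d c + frag_append e c"
  "frag_append (- d) c = - frag_append d c"
  "frag_append 0 c = 0"
  by (simp_all add: frag_append_def frag_linear frag_extend_add_fun frag_extend_diff_fun
      frag_extend_minus_fun frag_extend_eq_0)

lemma frag_append_pair: "frag_append (frag_of [x, w]) c = frag_cons x (frag_cons w c)"
  by (simp add: frag_append_def frag_map_compose) (simp add: frag_map_def comp_def)

text \<open>
  The Fox derivative of \<open>g\<close> telescopes: the sum of \<open>[w] - [x w]\<close> over its terms \<open>[x, w]\<close> is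
  \<open>[1] - [g]\<close>.
\<close>

lemma (in group) fox_boundary:
  assumes free: "free_on G S" and g: "g \<in> carrier G" and y: "y \<in> carrier G"
  shows "bar_boundary G (frag_append (fox G S g) (frag_of (y # r))) =
    frag_of (\<one> # y # r) - frag_of (g # y # r)
    + frag_append (frag_map (\<lambda>l. [l ! 0, l ! 1 \<otimes> y]) (fox G S g)) (frag_of r)
    + frag_append (fox G S g) (bar_boundary G (frag_of (y # r)))
    - frag_append (fox G S g) (frag_of r)"
proof -
  obtain w where w: "fst ` set w \<subseteq> S" "word_value G w = g"
    using free g by (rule free_on_word)
  have S: "S \<subseteq> carrier G"
    using free by (simp add: free_on_def)
  have pair: "bar_boundary G (frag_append (frag_of [x, v]) (frag_of (y # r))) =
    frag_of (v # y # r) - frag_of ((x \<otimes> v) # y # r)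
    + frag_append (frag_map (\<lambda>l. [l ! 0, l ! 1 \<otimes> y]) (frag_of [x, v])) (frag_of r)
    + frag_append (frag_of [x, v]) (bar_boundary G (frag_of (y # r)))
    - frag_append (frag_of [x, v]) (frag_of r)" for x v
    by (simp add: frag_append_pair bar_boundary_Cons_Cons [of G x] bar_boundary_Cons_Cons [of G v]
        bar_linear)
  have "bar_boundary G (frag_append (word_fox G w) (frag_of (y # r))) =
    frag_of (\<one> # y # r) - frag_of (word_value G w # y # r)
    + frag_append (frag_map (\<lambda>l. [l ! 0, l ! 1 \<otimes> y]) (word_fox G w)) (frag_of r)
    + frag_append (word_fox G w) (bar_boundary G (frag_of (y # r)))
    - frag_append (word_fox G w) (frag_of r)"
    using w(1)
  proof (induction w)
    case Nil
    then show ?case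
      by (simp add: frag_append_linear bar_boundary_linear)
  next
    case (Cons l w)
    then have "fst l \<in> carrier G" "word_value G w \<in> carrier G"
      using S by (auto intro!: word_value_closed)
    moreover have "fst ` set w \<subseteq> S"
      using Cons.prems by simp
    ultimately show ?case
      by (simp del: frag_append_of
          add: frag_append_linear bar_boundary_linear frag_linear Cons.IH pair
          flip: m_assoc)
  qed
  then show ?thesis
    using fox_word_value [OF free w(1)] w(2) by simp
qed

text \<open>The first entry is exchanged for its Fox derivative, a combination of pairs, so the
  degree rises by one.\<close>

definition fox_homotopy :: "('a, 'm) monoid_scheme \<Rightarrow> 'a set \<Rightarrow> ('a list \<Rightarrow>\<^sub>0 int) \<Rightarrow> ('a list \<Rightarrow>\<^sub>0 int)" where
  "fox_homotopy G S = frag_extend (\<lambda>l. frag_append (fox G S (hd l)) (frag_of (tl l)))"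

lemma fox_homotopy_linear:
  "fox_homotopy G S (a - b) = fox_homotopy G S a - fox_homotopy G S b"
  "fox_homotopy G S (a + b) = fox_homotopy G S a + fox_homotopy G S b"
  "fox_homotopy G S 0 = 0"
  by (simp_all add: fox_homotopy_def frag_extend_linear)

text \<open>The product rule splits the derivative of the product of the first two entries
  \<open>g\<close> and \<open>y\<close>. One part cancels against the face dropping
  \<open>g\<close>, the other against the right translate in \<open>fox_boundary\<close>. What
  survives moves the first entry to \<open>\<one>\<close>.\<close>

lemma (in group) fox_homotopy_identity:
  assumes "free_on G S" "c \<in> bar_chains (Suc (Suc n)) G"
  shows "bar_boundary G (fox_homotopy G S c) + fox_homotopy G S (bar_boundary G c)
    = frag_map (\<lambda>l. \<one> # tl l) c - c"
  using assms(2)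
proof (rule frag_span_linear_eq)
  fix l assume "l \<in> bar_tuples (Suc (Suc n)) G"
  then obtain g y r where l: "l = g # y # r" "g \<in> carrier G" "y \<in> carrier G"
    by (auto simp: length_Suc_conv)
  have cons: "fox_homotopy G S (frag_cons g c) = frag_append (fox G S g) c" for c
    by (simp add: fox_homotopy_def frag_append_def frag_extend_map comp_def)
  have gen: "fox_homotopy G S (frag_of (h # s)) = frag_append (fox G S h) (frag_of s)" for h s
    by (simp add: fox_homotopy_def)
  show "bar_boundary G (fox_homotopy G S (frag_of l)) + fox_homotopy G S (bar_boundary G (frag_of l))
    = frag_map (\<lambda>l. \<one> # tl l) (frag_of l) - frag_of l"
    using fox_mult [OF assms(1) l(2,3)]
    by (simp add: l(1) bar_boundary_Cons_Cons [of G g] fox_homotopy_linear cons gen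
        fox_boundary [OF assms(1) l(2,3)] frag_append_linear del: frag_append_of)
qed (simp_all add: fox_homotopy_linear bar_linear)

theorem (in group) free_group_acyclic:
  assumes "free_group G" "2 \<le> n"
  shows "bar_cycles n G \<subseteq> bar_boundaries n G"
proof
  fix c assume c: "c \<in> bar_cycles n G"
  obtain S where S: "free_on G S"
    using assms(1) by (auto simp: free_group_def)
  obtain m where n: "n = Suc (Suc m)"
    using assms(2) by (metis add_2_eq_Suc le_Suc_ex)
  have chain: "c \<in> bar_chains n G" and cycle: "bar_boundary G c = 0"
    using c by (auto simp: bar_cycles_def)
  \<comment> \<open>The homotopy will show that \<open>c\<close> is homologous to this chain, all of
    whose first entries are \<open>\<one>\<close>.\<close>
  define e where "e = frag_map (\<lambda>l. \<one> # tl l) c"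
  have e: "e \<in> bar_chains n G"
    unfolding e_def using chain by (rule frag_map_span) (auto simp: n length_Suc_conv)
  have T: "fox_homotopy G S c \<in> bar_chains (Suc n) G"
    unfolding fox_homotopy_def using chain
  proof (rule frag_span_extend)
    fix l assume "l \<in> bar_tuples n G"
    then have "hd l \<in> carrier G" "length (tl l) = Suc m" "set (tl l) \<subseteq> carrier G"
      by (auto simp: n length_Suc_conv)
    with fox_span [OF S this(1)] show "frag_append (fox G S (hd l)) (frag_of (tl l)) \<in> bar_chains (Suc n) G"
      by (auto simp: n intro!: frag_map_span)
  qed
  have homotopy: "bar_boundary G (fox_homotopy G S c) = e - c"
    using fox_homotopy_identity [OF S, of c m] chain cycle by (simp add: n e_def fox_homotopy_linear)
  then have "bar_boundary G e = 0"
    using bar_boundary_boundary [OF is_group T] cycle by (simp add: bar_boundary_linear)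
  moreover have "e \<in> frag_span {gs. gs \<noteq> []}"
    using e by (auto simp: frag_span_def n)
  \<comment> \<open>Multiplying a first entry \<open>\<one>\<close> by \<open>\<one>\<close> changes
    nothing, so prepending a further \<open>\<one>\<close> gives a cone whose boundary is
    \<open>e\<close>.\<close>
  moreover have "frag_map (\<lambda>l. (\<one> \<otimes> hd l) # tl l) e = frag_map (\<lambda>l. \<one> # tl l) e"
    by (simp add: e_def frag_map_compose comp_def)
  ultimately have "bar_boundary G (frag_cons \<one> e) = e"
    by (simp add: bar_boundary_frag_cons)
  moreover have "frag_cons \<one> e \<in> bar_chains (Suc n) G"
    using e by (rule frag_map_span) auto
  ultimately have "e \<in> bar_boundaries n G"
    using bar_boundariesI [of "frag_cons \<one> e" n G] by simp
  moreover have "e - c \<in> bar_boundaries n G"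
    using bar_boundariesI [OF T] by (simp add: homotopy)
  ultimately have "e - (e - c) \<in> bar_boundaries n G"
    by (rule bar_boundaries_diff)
  then show "c \<in> bar_boundaries n G"
    by simp
qed

section \<open>The second homology of a direct product\<close>

lemma bar_boundary_pair:
  "bar_boundary G (frag_of [x, y]) = frag_of [y] - frag_of [x \<otimes>\<^bsub>G\<^esub> y] + frag_of [x]"
  by (simp add: bar_boundary_Cons_Cons)

lemma bar_boundary_triple:
  "bar_boundary G (frag_of [x, y, z]) = frag_of [y, z] - frag_of [x \<otimes>\<^bsub>G\<^esub> y, z]
     + frag_of [x, y \<otimes>\<^bsub>G\<^esub> z] - frag_of [x, y]"
  by (simp add: bar_boundary_Cons_Cons frag_linear)

text \<open>The shuffle product of two one-simplices. Its boundary is \<open>[y x] - [x y]\<close>,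
  so it is a cycle when \<open>x\<close> and \<open>y\<close> commute.\<close>

definition bar_cross :: "'a \<Rightarrow> 'a \<Rightarrow> ('a list \<Rightarrow>\<^sub>0 int)" where
  "bar_cross x y = frag_of [x, y] - frag_of [y, x]"

text \<open>The witness is the shuffle product of the bounding chain with \<open>[y]\<close>.\<close>

lemma bar_cross_boundary:
  assumes "f \<in> hom F G" "y \<in> carrier G"
    and commute: "\<And>x. x \<in> carrier F \<Longrightarrow> f x \<otimes>\<^bsub>G\<^esub> y = y \<otimes>\<^bsub>G\<^esub> f x"
    and c: "c \<in> bar_boundaries 1 F"
  shows "frag_extend (\<lambda>l. bar_cross (f (hd l)) y) c \<in> bar_boundaries 2 G"
proof -
  obtain d where d: "d \<in> bar_chains 2 F" "c = bar_boundary F d"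
    using c by (auto simp: bar_boundaries_eq numeral_2_eq_2)
  define T where "T = frag_extend (\<lambda>l. frag_of [f (l ! 0), f (l ! 1), y]
    - frag_of [f (l ! 0), y, f (l ! 1)] + frag_of [y, f (l ! 0), f (l ! 1)])"
  have closed: "f x \<in> carrier G" if "x \<in> carrier F" for x
    using assms(1) that by (auto simp: hom_def)
  have "T d \<in> bar_chains (Suc 2) G"
    unfolding T_def using d(1)
    by (rule frag_span_extend) (auto simp: closed assms(2) numeral_2_eq_2 length_Suc_conv intro!: frag_span_arith)
  moreover have "bar_boundary G (T d) = frag_extend (\<lambda>l. bar_cross (f (hd l)) y) (bar_boundary F d)"
    using d(1)
  proof (rule frag_span_linear_eq)
    fix l assume "l \<in> bar_tuples 2 F"
    then obtain a b where "l = [a, b]" "a \<in> carrier F" "b \<in> carrier F"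
      by (auto simp: numeral_2_eq_2 length_Suc_conv)
    then show "bar_boundary G (T (frag_of l))
        = frag_extend (\<lambda>l. bar_cross (f (hd l)) y) (bar_boundary F (frag_of l))"
      by (simp add: T_def bar_linear bar_boundary_pair bar_boundary_triple bar_cross_def commute
          hom_mult [OF assms(1)])
  qed (simp_all add: T_def bar_linear)
  ultimately show ?thesis
    unfolding d(2) using bar_boundariesI by metis
qed

text \<open>Pairs stand for tensors of one-simplices; this is the Kuenneth cross product from
  degrees one and one, on chains.\<close>

definition bar_cross_sum :: "('a, 'm) monoid_scheme \<Rightarrow> ('b, 'n) monoid_scheme \<Rightarrow>
    ('a \<times> 'b \<Rightarrow>\<^sub>0 int) \<Rightarrow> (('a \<times> 'b) list \<Rightarrow>\<^sub>0 int)" where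
  "bar_cross_sum G H = frag_extend (\<lambda>(x, y). bar_cross (x, \<one>\<^bsub>H\<^esub>) (\<one>\<^bsub>G\<^esub>, y))"

lemma bar_cross_sum_linear:
  "bar_cross_sum G H (a - b) = bar_cross_sum G H a - bar_cross_sum G H b"
  "bar_cross_sum G H 0 = 0"
  by (simp_all add: bar_cross_sum_def frag_extend_linear)

lemma bar_cross_sum_of [simp]:
  "bar_cross_sum G H (frag_of (x, y)) = bar_cross (x, \<one>\<^bsub>H\<^esub>) (\<one>\<^bsub>G\<^esub>, y)"
  by (simp add: bar_cross_sum_def)

text \<open>
  Writing \<open>a = f g\<close> for the factors \<open>f \<in> G\<close> and \<open>g \<in> H\<close> of \<open>a\<close>, the boundary relations
  of \<open>[f\<^sub>1|g\<^sub>1|a\<^sub>2]\<close>, \<open>[g\<^sub>1|g\<^sub>2|f\<^sub>2]\<close> and \<open>[f\<^sub>1|f\<^sub>2|g\<^sub>1g\<^sub>2]\<close> split \<open>[a\<^sub>1|a\<^sub>2]\<close> into \<open>[f\<^sub>1|f\<^sub>2]\<close>,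
  \<open>[g\<^sub>1|g\<^sub>2]\<close>, cross products, and the image of the boundary under \<open>[a] \<mapsto> [f|g]\<close>, which
  vanishes on cycles.
\<close>

lemma DirProd_cycle_2:
  assumes "group G" "group H" and z: "z \<in> bar_cycles 2 (G \<times>\<times> H)"
  obtains k where "k \<in> frag_span (carrier G \<times> carrier H)"
    "z - bar_map (\<lambda>x. (x, \<one>\<^bsub>H\<^esub>)) (bar_map fst z) - bar_map (\<lambda>y. (\<one>\<^bsub>G\<^esub>, y)) (bar_map snd z)
       - bar_cross_sum G H k \<in> bar_boundaries 2 (G \<times>\<times> H)"
proof
  interpret G: group G by fact
  interpret H: group H by fact
  let ?A = "G \<times>\<times> H"
  let ?g = "\<lambda>a. (fst a, \<one>\<^bsub>H\<^esub>)" and ?h = "\<lambda>a. (\<one>\<^bsub>G\<^esub>, snd a)"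
  define \<kappa> where "\<kappa> = frag_extend (\<lambda>l. let a = l ! 0; b = l ! 1 in
    frag_of [?g a, ?h a, b] - frag_of [?h a, ?h b, ?g b] - frag_of [?g a, ?g b, ?h (a \<otimes>\<^bsub>?A\<^esub> b)])"
  \<comment> \<open>By additivity of cross products up to boundaries, this difference represents
    minus the pair (f_2, g_1), the cost of moving f_2 past g_1. In the form chosen the identity
    below holds exactly on chains.\<close>
  define K where "K = frag_extend (\<lambda>l. let a = l ! 0; b = l ! 1 in
    frag_of (fst b, snd b) - frag_of (fst b, snd (a \<otimes>\<^bsub>?A\<^esub> b)))"
  define L where "L = frag_map (\<lambda>l. [?g (hd l), ?h (hd l)])"
  have chain: "z \<in> bar_chains 2 ?A" and cycle: "bar_boundary ?A z = 0"
    using z by (auto simp: bar_cycles_def)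
  show "K z \<in> frag_span (carrier G \<times> carrier H)"
    unfolding K_def using chain
    by (rule frag_span_extend) (auto simp: numeral_2_eq_2 length_Suc_conv Let_def intro!: frag_span_arith)
  have "\<kappa> z \<in> bar_chains (Suc 2) ?A"
    unfolding \<kappa>_def using chain
    by (rule frag_span_extend) (auto simp: numeral_2_eq_2 length_Suc_conv Let_def intro!: frag_span_arith)
  moreover have "- bar_boundary ?A (\<kappa> z) = z - bar_map (\<lambda>x. (x, \<one>\<^bsub>H\<^esub>)) (bar_map fst z)
      - bar_map (\<lambda>y. (\<one>\<^bsub>G\<^esub>, y)) (bar_map snd z) - bar_cross_sum G H (K z) + L (bar_boundary ?A z)"
    using chain
  proof (rule frag_span_linear_eq)
    fix l assume "l \<in> bar_tuples 2 ?A"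
    then obtain f1 g1 f2 g2 where "l = [(f1, g1), (f2, g2)]"
      "f1 \<in> carrier G" "f2 \<in> carrier G" "g1 \<in> carrier H" "g2 \<in> carrier H"
      by (auto simp: numeral_2_eq_2 length_Suc_conv)
    then show "- bar_boundary ?A (\<kappa> (frag_of l)) = frag_of l
      - bar_map (\<lambda>x. (x, \<one>\<^bsub>H\<^esub>)) (bar_map fst (frag_of l))
      - bar_map (\<lambda>y. (\<one>\<^bsub>G\<^esub>, y)) (bar_map snd (frag_of l))
      - bar_cross_sum G H (K (frag_of l)) + L (bar_boundary ?A (frag_of l))"
      by (simp add: \<kappa>_def K_def L_def Let_def bar_linear bar_boundary_pair bar_boundary_triple
          bar_cross_def bar_cross_sum_linear)
  qed (simp_all add: \<kappa>_def K_def L_def bar_linear bar_map_linear bar_cross_sum_linear)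
  ultimately show "z - bar_map (\<lambda>x. (x, \<one>\<^bsub>H\<^esub>)) (bar_map fst z)
      - bar_map (\<lambda>y. (\<one>\<^bsub>G\<^esub>, y)) (bar_map snd z) - bar_cross_sum G H (K z) \<in> bar_boundaries 2 ?A"
    using bar_boundaries_minus [OF bar_boundariesI, of "\<kappa> z" 2 ?A]
    by (simp add: cycle L_def)
qed

lemma DirProd_inl_hom: "group H \<Longrightarrow> (\<lambda>x. (x, \<one>\<^bsub>H\<^esub>)) \<in> hom G (G \<times>\<times> H)"
  and DirProd_inr_hom: "group G \<Longrightarrow> (\<lambda>y. (\<one>\<^bsub>G\<^esub>, y)) \<in> hom H (G \<times>\<times> H)"
  and DirProd_fst_hom: "fst \<in> hom (G \<times>\<times> H) G"
  and DirProd_snd_hom: "snd \<in> hom (G \<times>\<times> H) H"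
  by (auto simp: hom_def group.is_monoid monoid.one_closed monoid.r_one)

text \<open>The entries are exchanged one at a time: first \<open>x\<close> for \<open>r\<close>
  against \<open>y\<close>, then, using antisymmetry of \<open>bar_cross\<close>, \<open>y\<close>
  for \<open>s\<close> against \<open>r\<close>.\<close>

lemma bar_cross_sum_change:
  assumes "group G" "group H" "x \<in> carrier G" "y \<in> carrier H" "r \<in> carrier G" "s \<in> carrier H"
    and "frag_of [x] - frag_of [r] \<in> bar_boundaries 1 G"
    and "frag_of [y] - frag_of [s] \<in> bar_boundaries 1 H"
  shows "bar_cross_sum G H (frag_of (x, y) - frag_of (r, s)) \<in> bar_boundaries 2 (G \<times>\<times> H)"
proof -
  interpret G: group G by fact
  interpret H: group H by fact
  have "bar_cross (x, \<one>\<^bsub>H\<^esub>) (\<one>\<^bsub>G\<^esub>, y) - bar_cross (r, \<one>\<^bsub>H\<^esub>) (\<one>\<^bsub>G\<^esub>, y) \<in> bar_boundaries 2 (G \<times>\<times> H)"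
    using bar_cross_boundary [OF DirProd_inl_hom [OF \<open>group H\<close>] _ _ assms(7), of "(\<one>\<^bsub>G\<^esub>, y)"] assms(4)
    by (simp add: frag_extend_diff)
  moreover have "bar_cross (\<one>\<^bsub>G\<^esub>, y) (r, \<one>\<^bsub>H\<^esub>) - bar_cross (\<one>\<^bsub>G\<^esub>, s) (r, \<one>\<^bsub>H\<^esub>) \<in> bar_boundaries 2 (G \<times>\<times> H)"
    using bar_cross_boundary [OF DirProd_inr_hom [OF \<open>group G\<close>] _ _ assms(8), of "(r, \<one>\<^bsub>H\<^esub>)"] assms(5)
    by (simp add: frag_extend_diff)
  ultimately show ?thesis
    using bar_boundaries_diff by (fastforce simp: bar_cross_sum_linear bar_cross_def)
qed

text \<open>The factor components of \<open>z\<close> come from 2-cycles of free groups and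
  therefore bound, which leaves cross products. Their entries matter only up to homology, so they
  can be moved into any sets \<open>R\<close> and \<open>S\<close> that represent the classes of all
  group elements.\<close>

proposition free_DirProd_cycle_2:
  assumes "group G" "group H" "free_group G" "free_group H"
    and z: "z \<in> bar_cycles 2 (G \<times>\<times> H)"
    and R: "R \<subseteq> carrier G" "\<And>x. x \<in> carrier G \<Longrightarrow> \<exists>r\<in>R. frag_of [x] - frag_of [r] \<in> bar_boundaries 1 G"
    and S: "S \<subseteq> carrier H" "\<And>y. y \<in> carrier H \<Longrightarrow> \<exists>s\<in>S. frag_of [y] - frag_of [s] \<in> bar_boundaries 1 H"
  obtains k where "k \<in> frag_span (R \<times> S)"
    "z - bar_cross_sum G H k \<in> bar_boundaries 2 (G \<times>\<times> H)"
proof -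
  let ?B = "bar_boundaries 2 (G \<times>\<times> H)"
  obtain k where k: "k \<in> frag_span (carrier G \<times> carrier H)"
    "z - bar_map (\<lambda>x. (x, \<one>\<^bsub>H\<^esub>)) (bar_map fst z) - bar_map (\<lambda>y. (\<one>\<^bsub>G\<^esub>, y)) (bar_map snd z)
       - bar_cross_sum G H k \<in> ?B"
    using DirProd_cycle_2 [OF assms(1,2) z] .
  have "bar_map fst z \<in> bar_boundaries 2 G" "bar_map snd z \<in> bar_boundaries 2 H"
    using bar_cycles_map [OF DirProd_fst_hom z] bar_cycles_map [OF DirProd_snd_hom z]
      group.free_group_acyclic [of G 2] group.free_group_acyclic [of H 2] assms(1-4) by auto
  then have "bar_map (\<lambda>x. (x, \<one>\<^bsub>H\<^esub>)) (bar_map fst z) \<in> ?B" "bar_map (\<lambda>y. (\<one>\<^bsub>G\<^esub>, y)) (bar_map snd z) \<in> ?B"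
    using bar_boundaries_map DirProd_inl_hom DirProd_inr_hom assms(1,2) by metis+
  from bar_boundaries_add [OF bar_boundaries_add [OF k(2) this(2)] this(1)]
  have zk: "z - bar_cross_sum G H k \<in> ?B"
    by (simp add: algebra_simps)
  have "\<exists>k'\<in>frag_span (R \<times> S). bar_cross_sum G H (k - k') \<in> ?B"
    using k(1)
  proof (induction rule: frag_span_induct)
    case zero
    show ?case
      by (rule bexI [of _ 0]) (auto simp: bar_cross_sum_linear)
  next
    case (of a)
    then obtain x y where a: "a = (x, y)" "x \<in> carrier G" "y \<in> carrier H"
      by auto
    obtain r s where rs: "r \<in> R" "frag_of [x] - frag_of [r] \<in> bar_boundaries 1 G"
      "s \<in> S" "frag_of [y] - frag_of [s] \<in> bar_boundaries 1 H"
      using R(2) [OF a(2)] S(2) [OF a(3)] by auto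
    then have "bar_cross_sum G H (frag_of (x, y) - frag_of (r, s)) \<in> ?B"
      using bar_cross_sum_change [OF assms(1,2) a(2,3), of r s] R(1) S(1) by auto
    then show ?case
      using rs by (intro bexI [of _ "frag_of (r, s)"]) (auto simp: a(1))
  next
    case (diff a b)
    then obtain a' b' where ab: "a' \<in> frag_span (R \<times> S)" "b' \<in> frag_span (R \<times> S)"
      "bar_cross_sum G H (a - a') \<in> ?B" "bar_cross_sum G H (b - b') \<in> ?B"
      by auto
    from bar_boundaries_diff [OF ab(3,4)]
    have "bar_cross_sum G H (a - b - (a' - b')) \<in> ?B"
      by (simp only: bar_cross_sum_linear) (simp add: algebra_simps)
    with ab show ?case
      by (blast intro: frag_span_diff)
  qed
  then obtain k' where k': "k' \<in> frag_span (R \<times> S)" "bar_cross_sum G H (k - k') \<in> ?B"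
    by blast
  show ?thesis
    using that [OF k'(1)] bar_boundaries_add [OF zk k'(2)] by (simp add: bar_cross_sum_linear)
qed

section \<open>The fiber square of an epimorphism\<close>

lemma pair_in_boundaries:
  assumes "group G" "x \<in> carrier G" "y \<in> carrier G"
  shows "frag_of [y] - frag_of [x \<otimes>\<^bsub>G\<^esub> y] + frag_of [x] \<in> bar_boundaries 1 G"
  using bar_boundariesI [of "frag_of [x, y]" 1 G] assms by (simp add: bar_boundary_pair)

lemma one_in_boundaries:
  assumes "group G"
  shows "frag_of [\<one>\<^bsub>G\<^esub>] \<in> bar_boundaries 1 G"
proof -
  interpret group G by fact
  show ?thesis
    using pair_in_boundaries [OF assms, of "\<one>\<^bsub>G\<^esub>" "\<one>\<^bsub>G\<^esub>"] by simp
qed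

lemma div_in_boundaries:
  assumes "group G" "x \<in> carrier G" "y \<in> carrier G"
  shows "frag_of [x] - frag_of [y] - frag_of [x \<otimes>\<^bsub>G\<^esub> inv\<^bsub>G\<^esub> y] \<in> bar_boundaries 1 G"
proof -
  interpret group G by fact
  show ?thesis
    using bar_boundaries_minus [OF pair_in_boundaries [OF assms(1), of "x \<otimes>\<^bsub>G\<^esub> inv\<^bsub>G\<^esub> y" y]] assms(2,3)
    by (simp add: m_assoc algebra_simps)
qed

locale group_epi =
  fixes F :: "('f, 'm) monoid_scheme" and Q :: "('q, 'n) monoid_scheme" and p :: "'f \<Rightarrow> 'q"
  assumes group_F: "group F" and group_Q: "group Q" and epi: "p \<in> epi F Q"
begin

sublocale F: group F by (fact group_F)
sublocale Q: group Q by (fact group_Q)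

abbreviation P :: "('f \<times> 'f) monoid" where "P \<equiv> fiber_product F p"

lemma hom: "p \<in> hom F Q" and surj: "p ` carrier F = carrier Q"
  using epi by (auto simp: epi_def)

sublocale p: group_hom F Q p
  by unfold_locales (fact hom)

lemma carrier_P: "carrier P = {(x, y). x \<in> carrier F \<and> y \<in> carrier F \<and> p x = p y}"
  and mult_P [simp]: "(x, y) \<otimes>\<^bsub>P\<^esub> (x', y') = (x \<otimes>\<^bsub>F\<^esub> x', y \<otimes>\<^bsub>F\<^esub> y')"
  by (simp_all add: fiber_product_def)

lemma group_P: "group P"
proof -
  interpret FF: group "F \<times>\<times> F"
    by (rule DirProd_group) unfold_locales
  have "subgroup {(x, y). x \<in> carrier F \<and> y \<in> carrier F \<and> p x = p y} (F \<times>\<times> F)"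
    by (rule FF.subgroupI) (auto intro!: exI [of _ "\<one>\<^bsub>F\<^esub>"] simp: inv_DirProd [OF group_F group_F])
  then show ?thesis
    unfolding fiber_product_def by (rule FF.subgroup_imp_group)
qed

lemma fst_hom: "fst \<in> hom P F" and snd_hom: "snd \<in> hom P F"
  and diag_hom: "(\<lambda>x. (x, x)) \<in> hom F P"
  and incl_hom: "(\<lambda>z. z) \<in> hom P (F \<times>\<times> F)"
  by (auto simp: hom_def carrier_P)

section \<open>Bar chains of the quotient as a cokernel of the two projections\<close>

lemma lift_chain:
  assumes "c \<in> bar_chains n Q"
  obtains d where "d \<in> bar_chains n F" "bar_map p d = c"
proof -
  have sub: "bar_tuples n Q \<subseteq> map p ` bar_tuples n F"
  proof
    fix l assume l: "l \<in> bar_tuples n Q"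
    let ?m = "map (inv_into (carrier F) p) l"
    have "inv_into (carrier F) p x \<in> carrier F \<and> p (inv_into (carrier F) p x) = x" if "x \<in> set l" for x
      using l that surj by (auto simp: inv_into_into f_inv_into_f)
    with l have "?m \<in> bar_tuples n F" "l = map p ?m"
      by (auto simp: map_idI)
    then show "l \<in> map p ` bar_tuples n F"
      by (intro image_eqI)
  qed
  show ?thesis
    using frag_map_lift [OF assms sub] that unfolding bar_map_eq_frag_map .
qed

text \<open>Two tuples of \<open>F\<close> with the same image under \<open>p\<close> agree over
  \<open>Q\<close> entry by entry, so zipping them gives a tuple of the fiber product. This turns
  \<open>frag_map_kernel\<close> for tuples into a statement about bar chains.\<close>

lemma chain_kernel:
  assumes "c \<in> bar_chains n F" "bar_map p c = 0"
  obtains w where "w \<in> bar_chains n P" "c = bar_map fst w - bar_map snd w"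
proof -
  let ?S = "{(a, b). a \<in> bar_tuples n F \<and> b \<in> bar_tuples n F \<and> map p a = map p b}"
  obtain v where v: "v \<in> frag_span ?S" "c = frag_map fst v - frag_map snd v"
    using frag_map_kernel [OF assms [unfolded bar_map_eq_frag_map]] .
  show ?thesis
  proof
    show "frag_map (\<lambda>(a, b). zip a b) v \<in> bar_chains n P"
      using v(1)
    proof (rule frag_map_span)
      fix ab assume "ab \<in> ?S"
      then obtain a b where ab: "ab = (a, b)" "length a = n" "length b = n" "map p a = map p b"
        "set a \<subseteq> carrier F" "set b \<subseteq> carrier F"
        by auto
      have "p (a ! i) = p (b ! i)" if "i < n" for i
        using that ab(2,3) arg_cong [OF ab(4), of "\<lambda>l. l ! i"] by simp
      then show "(case ab of (a, b) \<Rightarrow> zip a b) \<in> bar_tuples n P"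
        using ab by (auto simp: carrier_P set_zip subset_iff)
    qed
    have "frag_map (map fst \<circ> (\<lambda>(a, b). zip a b)) v = frag_map fst v"
      "frag_map (map snd \<circ> (\<lambda>(a, b). zip a b)) v = frag_map snd v"
      by (rule frag_map_cong [OF v(1)]; force)+
    then show "c = bar_map fst (frag_map (\<lambda>(a, b). zip a b) v) - bar_map snd (frag_map (\<lambda>(a, b). zip a b) v)"
      by (simp add: v(2) bar_map_eq_frag_map frag_map_compose)
  qed
qed

lemma map_fst_eq_map_snd:
  assumes "w \<in> bar_chains n P"
  shows "bar_map p (bar_map fst w) = bar_map p (bar_map snd w)"
  unfolding bar_map_eq_frag_map frag_map_compose
  using assms by (rule frag_map_cong) (auto simp: carrier_P subset_iff)

text \<open>
  The bounding chain comes from the factorization \<open>(x, s) = (x, y) (1, y\<inverse> s)\<close> in the fiber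
  product, where \<open>s\<close> is a chosen representative of the common image of \<open>x\<close> and \<open>y\<close>.
\<close>

lemma chain_1_diagonal:
  assumes v: "v \<in> bar_chains 1 P" and eq: "bar_map fst v = bar_map snd v"
  obtains t where "t \<in> bar_chains 2 P" "bar_map fst t = bar_map snd t"
    "bar_boundary P t = v - bar_map (\<lambda>x. (x, x)) (bar_map snd v)"
proof -
  let ?S = "{(x, y, s). x \<in> carrier F \<and> y \<in> carrier F \<and> s \<in> carrier F \<and> p x = p y \<and> p x = p s}"
  define w where "w = frag_map hd v"
  have w: "w \<in> frag_span {(x, y). x \<in> carrier F \<and> y \<in> carrier F \<and> p x = p y}"
    unfolding w_def using v by (rule frag_map_span) (auto simp: length_Suc_conv carrier_P)
  have v_w: "v = frag_map (\<lambda>z. [z]) w"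
  proof -
    have "frag_map ((\<lambda>z. [z]) \<circ> hd) v = frag_map (\<lambda>z. z) v"
      using v by (rule frag_map_cong) (auto simp: length_Suc_conv)
    then show ?thesis
      by (simp add: w_def frag_map_compose)
  qed
  have "frag_map fst w = frag_map hd (bar_map fst v)" "frag_map snd w = frag_map hd (bar_map snd v)"
    by (simp_all add: v_w bar_map_eq_frag_map frag_map_compose comp_def)
  with eq have "frag_map fst w = frag_map snd w"
    by simp
  then obtain u where u: "u \<in> frag_span ?S" and uw: "frag_map (\<lambda>(x, y, s). (x, y)) u = w"
    and us: "frag_map (\<lambda>(x, y, s). (x, s)) u = frag_map (\<lambda>(x, y, s). (y, s)) u"
    using frag_map_pair_kernel [OF w] by blast
  have uxy: "frag_map fst u = frag_map (\<lambda>a. fst (snd a)) u"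
    using arg_cong [OF us, of "frag_map fst"] by (simp add: frag_map_compose comp_def case_prod_beta)
  \<comment> \<open>The subtracted bracket factors \<open>(y, s)\<close> in the same way and cancels
    the common face. The second projections cancel at once; the first ones become
    \<open>[x, 1] - [y, 1]\<close> and vanish after summation.\<close>
  define T where "T = frag_extend (\<lambda>(x, y, s). frag_of [(x, y), (\<one>\<^bsub>F\<^esub>, inv\<^bsub>F\<^esub> y \<otimes>\<^bsub>F\<^esub> s)]
    - frag_of [(y, y), (\<one>\<^bsub>F\<^esub>, inv\<^bsub>F\<^esub> y \<otimes>\<^bsub>F\<^esub> s)])"
  show ?thesis
  proof
    show "T u \<in> bar_chains 2 P"
      unfolding T_def using u by (rule frag_span_extend) (auto simp: carrier_P intro!: frag_span_arith)
    have "bar_map fst (T u) - bar_map snd (T u)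
        = frag_map (\<lambda>x. [x, \<one>\<^bsub>F\<^esub>]) (frag_map fst u - frag_map (\<lambda>a. fst (snd a)) u)"
      using u by (rule frag_span_linear_eq) (auto simp: T_def frag_linear bar_map_linear)
    then show "bar_map fst (T u) = bar_map snd (T u)"
      by (simp add: uxy)
    have "bar_boundary P (T u) = frag_map (\<lambda>z. [z]) (frag_map (\<lambda>(x, y, s). (x, y)) u
        - frag_map (\<lambda>(x, y, s). (x, s)) u + frag_map (\<lambda>(x, y, s). (y, s)) u
        - frag_map (\<lambda>(x, y, s). (y, y)) u)"
      using u by (rule frag_span_linear_eq)
        (auto simp: T_def bar_linear bar_boundary_pair simp flip: F.m_assoc)
    also have "\<dots> = v - frag_map (\<lambda>z. [z]) (frag_map (\<lambda>(x, y, s). (y, y)) u)"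
      by (simp add: us uw v_w frag_linear)
    also have "frag_map (\<lambda>z. [z]) (frag_map (\<lambda>(x, y, s). (y, y)) u) = bar_map (\<lambda>x. (x, x)) (bar_map snd v)"
      by (simp add: v_w flip: uw) (simp add: bar_map_eq_frag_map frag_map_compose comp_def case_prod_beta)
    finally show "bar_boundary P (T u) = v - bar_map (\<lambda>x. (x, x)) (bar_map snd v)" .
  qed
qed

lemma boundary_fst_snd:
  assumes "w \<in> bar_chains n P"
  shows "bar_boundary F (bar_map fst w - bar_map snd w)
    = bar_map fst (bar_boundary P w) - bar_map snd (bar_boundary P w)"
  using assms by (simp add: bar_boundary_linear bar_boundary_map [OF fst_hom] bar_boundary_map [OF snd_hom])

text \<open>Writing \<open>c\<close> as a difference of projections of a chain \<open>w\<close> only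
  ensures that the boundary of \<open>w\<close> has equal projections. Subtracting a diagonal chain
  and the chain from \<open>chain_1_diagonal\<close> turns \<open>w\<close> into a cycle. Both
  corrections have equal projections, so the difference remains \<open>c\<close>.\<close>

lemma cycle_2_fst_snd:
  assumes c: "c \<in> bar_cycles 2 F" and pc: "bar_map p c = 0"
  obtains w where "w \<in> bar_cycles 2 P" "c = bar_map fst w - bar_map snd w"
proof -
  obtain w where w: "w \<in> bar_chains 2 P" "c = bar_map fst w - bar_map snd w"
    using chain_kernel [OF _ pc, of 2] c by (auto simp: bar_cycles_def)
  let ?d = "bar_map (\<lambda>x. (x, x)) (bar_map snd w)"
  have "bar_map fst (bar_boundary P w) = bar_map snd (bar_boundary P w)"
    using c boundary_fst_snd [OF w(1)] w(2) by (simp add: bar_cycles_def)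
  moreover have "bar_boundary P w \<in> bar_chains 1 P"
    using bar_boundary_chain [OF group_P, of w 1] w(1) by (simp add: numeral_2_eq_2)
  ultimately obtain t where t: "t \<in> bar_chains 2 P" "bar_map fst t = bar_map snd t"
    "bar_boundary P t = bar_boundary P w - bar_map (\<lambda>x. (x, x)) (bar_map snd (bar_boundary P w))"
    using chain_1_diagonal by blast
  have sw: "bar_map snd w \<in> bar_chains 2 F"
    using bar_map_chain [of snd P F w 2] w(1) snd_hom by (auto simp: hom_def)
  then have d: "?d \<in> bar_chains 2 P"
    using bar_map_chain [of "\<lambda>x. (x, x)" F P _ 2] diag_hom by (auto simp: hom_def)
  have "bar_boundary P ?d = bar_map (\<lambda>x. (x, x)) (bar_map snd (bar_boundary P w))"
    by (simp add: bar_boundary_map [OF diag_hom sw] bar_boundary_map [OF snd_hom w(1)])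
  then have "bar_boundary P (w - ?d - t) = 0"
    by (simp add: bar_boundary_linear t(3))
  then have "w - ?d - t \<in> bar_cycles 2 P"
    using frag_span_diff [OF frag_span_diff [OF w(1) d] t(1)] by (simp add: bar_cycles_def)
  moreover have "bar_map fst ?d = bar_map snd ?d"
    by (simp add: bar_map_eq_frag_map frag_map_compose comp_def)
  then have "bar_map fst (w - ?d - t) - bar_map snd (w - ?d - t) = c"
    by (simp add: bar_map_linear t(2) w(2))
  ultimately show ?thesis
    by (intro that [OF _ sym])
qed

section \<open>Injectivity on first homology\<close>

lemma fiber_product_H1_inj:
  assumes H2: "bar_cycles 2 Q \<subseteq> bar_boundaries 2 Q"
    and w: "w \<in> bar_chains 1 P" "w \<in> bar_boundaries 1 (F \<times>\<times> F)"
  shows "w \<in> bar_boundaries 1 P"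
proof -
  have fs: "bar_map fst w \<in> bar_boundaries 1 F" "bar_map snd w \<in> bar_boundaries 1 F"
    using bar_boundaries_map [OF DirProd_fst_hom w(2)] bar_boundaries_map [OF DirProd_snd_hom w(2)]
    by auto
  then obtain c where c: "c \<in> bar_chains 2 F" "bar_map fst w - bar_map snd w = bar_boundary F c"
    using bar_boundaries_diff [OF fs] by (auto simp: bar_boundaries_eq numeral_2_eq_2)
  \<comment> \<open>Over \<open>Q\<close> the two projections of \<open>w\<close> coincide, so
    \<open>c\<close> becomes a cycle there.\<close>
  have "bar_boundary Q (bar_map p c) = 0"
    using map_fst_eq_map_snd [OF w(1)] by (simp add: bar_boundary_map [OF hom c(1)] bar_map_linear flip: c(2))
  moreover have "bar_map p c \<in> bar_chains 2 Q"
    using bar_map_chain [of p F Q c 2] c(1) by auto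
  ultimately have "bar_map p c \<in> bar_boundaries 2 Q"
    using H2 by (auto simp: bar_cycles_def)
  then obtain e where "e \<in> bar_chains (Suc 2) Q" "bar_map p c = bar_boundary Q e"
    by (auto simp: bar_boundaries_eq)
  moreover from this(1) obtain d where d: "d \<in> bar_chains (Suc 2) F" "bar_map p d = e"
    by (rule lift_chain)
  \<comment> \<open>Changing \<open>c\<close> by a boundary makes it trivial over \<open>Q\<close>
    without affecting its own boundary.\<close>
  ultimately have "bar_map p (c - bar_boundary F d) = 0"
    by (simp add: bar_map_linear bar_boundary_map [OF hom d(1), symmetric])
  moreover have "c - bar_boundary F d \<in> bar_chains 2 F"
    using c(1) bar_boundary_chain [OF group_F d(1)] by (rule frag_span_diff)
  ultimately obtain v where v: "v \<in> bar_chains 2 P" "c - bar_boundary F d = bar_map fst v - bar_map snd v"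
    using chain_kernel by blast
  have "bar_boundary F c = bar_map fst (bar_boundary P v) - bar_map snd (bar_boundary P v)"
    using boundary_fst_snd [OF v(1)] bar_boundary_boundary [OF group_F d(1)]
    by (simp add: bar_boundary_linear flip: v(2))
  \<comment> \<open>After this correction by a boundary, \<open>w\<close> has equal projections and
    is homologous to a diagonal chain, which bounds because its projection bounds in
    \<open>F\<close>.\<close>
  then have eq: "bar_map fst (w - bar_boundary P v) = bar_map snd (w - bar_boundary P v)"
    unfolding c(2) [symmetric] bar_map_linear by (simp add: algebra_simps)
  have Bv: "bar_boundary P v \<in> bar_boundaries 1 P"
    using bar_boundariesI [of v 1 P] v(1) by (simp add: numeral_2_eq_2)
  then have "bar_boundary P v \<in> bar_chains 1 P"
    using bar_boundaries_subset_cycles [OF group_P, of 1] by (auto simp: bar_cycles_def)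
  with w(1) have "w - bar_boundary P v \<in> bar_chains 1 P"
    by (rule frag_span_diff)
  then obtain t where t: "t \<in> bar_chains 2 P"
    "bar_boundary P t = w - bar_boundary P v - bar_map (\<lambda>x. (x, x)) (bar_map snd (w - bar_boundary P v))"
    using chain_1_diagonal [OF _ eq] by blast
  have "bar_map snd (w - bar_boundary P v) \<in> bar_boundaries 1 F"
    using fs(2) bar_boundaries_map [OF snd_hom Bv] by (simp add: bar_map_linear bar_boundaries_diff)
  then have "bar_map (\<lambda>x. (x, x)) (bar_map snd (w - bar_boundary P v)) \<in> bar_boundaries 1 P"
    by (rule bar_boundaries_map [OF diag_hom])
  moreover have "bar_boundary P t \<in> bar_boundaries 1 P"
    using bar_boundariesI [of t 1 P] t(1) by (simp add: numeral_2_eq_2)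
  ultimately have "bar_boundary P t + bar_map (\<lambda>x. (x, x)) (bar_map snd (w - bar_boundary P v))
      + bar_boundary P v \<in> bar_boundaries 1 P"
    using Bv by (intro bar_boundaries_add)
  then show ?thesis
    by (simp add: t(2))
qed

section \<open>Representatives in the kernel and their cross products\<close>

abbreviation K :: "'f set" where "K \<equiv> kernel F Q p"

text \<open>Since \<open>[p x]\<close> bounds, lifting the bounding chain makes \<open>[x]\<close>
  homologous to a difference of projections from the fiber product. Each \<open>[a] - [b]\<close>
  with \<open>p a = p b\<close> is homologous to \<open>[a b^-1]\<close>, and combinations of kernel
  elements collapse to a single one in the same way.\<close>

lemma kernel_representative:
  assumes H1: "bar_cycles 1 Q \<subseteq> bar_boundaries 1 Q" and x: "x \<in> carrier F"
  shows "\<exists>r\<in>K. frag_of [x] - frag_of [r] \<in> bar_boundaries 1 F"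
proof -
  have K_sub: "K \<subseteq> carrier F"
    by (auto simp: kernel_def)
  have fst_snd: "\<exists>r\<in>K. bar_map fst w - bar_map snd w - frag_of [r] \<in> bar_boundaries 1 F"
    if "w \<in> bar_chains 1 P" for w
    using that
  proof (induction rule: frag_span_induct)
    case zero
    show ?case
      using one_in_boundaries [OF group_F]
      by (intro bexI [of _ "\<one>\<^bsub>F\<^esub>"]) (auto simp: bar_map_linear bar_boundaries_minus kernel_def)
  next
    case (of l)
    then obtain a b where "l = [(a, b)]" "a \<in> carrier F" "b \<in> carrier F" "p a = p b"
      by (auto simp: length_Suc_conv carrier_P)
    then show ?case
      using div_in_boundaries [OF group_F, of a b]
      by (intro bexI [of _ "a \<otimes>\<^bsub>F\<^esub> inv\<^bsub>F\<^esub> b"]) (auto simp: kernel_def)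
  next
    case (diff v w)
    then obtain r s where rs: "r \<in> K" "s \<in> K"
      "bar_map fst v - bar_map snd v - frag_of [r] \<in> bar_boundaries 1 F"
      "bar_map fst w - bar_map snd w - frag_of [s] \<in> bar_boundaries 1 F"
      by blast
    have "frag_of [r] - frag_of [s] - frag_of [r \<otimes>\<^bsub>F\<^esub> inv\<^bsub>F\<^esub> s] \<in> bar_boundaries 1 F"
      using rs(1,2) K_sub by (intro div_in_boundaries group_F) auto
    from bar_boundaries_add [OF bar_boundaries_diff [OF rs(3,4)] this]
    have "bar_map fst (v - w) - bar_map snd (v - w) - frag_of [r \<otimes>\<^bsub>F\<^esub> inv\<^bsub>F\<^esub> s] \<in> bar_boundaries 1 F"
      by (simp add: bar_map_linear algebra_simps)
    moreover have "r \<otimes>\<^bsub>F\<^esub> inv\<^bsub>F\<^esub> s \<in> K"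
      using rs(1,2) by (auto simp: kernel_def)
    ultimately show ?case
      by blast
  qed
  have "frag_of [p x] \<in> bar_boundaries 1 Q"
    using H1 x unfolding bar_cycles_1 by auto
  then obtain e where "e \<in> bar_chains 2 Q" "bar_boundary Q e = frag_of [p x]"
    by (auto simp: bar_boundaries_eq numeral_2_eq_2)
  moreover from this(1) obtain d where d: "d \<in> bar_chains 2 F" "bar_map p d = e"
    by (rule lift_chain)
  ultimately have "bar_map p (frag_of [x] - bar_boundary F d) = 0"
    by (simp add: bar_map_linear bar_boundary_map [OF hom d(1), symmetric])
  moreover have "frag_of [x] - bar_boundary F d \<in> bar_chains 1 F"
    using bar_boundary_chain [OF group_F, of d 1] d(1) x by (simp add: numeral_2_eq_2 frag_span_diff)
  ultimately obtain w where w: "w \<in> bar_chains 1 P"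
    "frag_of [x] - bar_boundary F d = bar_map fst w - bar_map snd w"
    using chain_kernel by blast
  from fst_snd [OF w(1), folded w(2)] obtain r where r: "r \<in> K"
    "frag_of [x] - bar_boundary F d - frag_of [r] \<in> bar_boundaries 1 F"
    by blast
  have "bar_boundary F d \<in> bar_boundaries 1 F"
    using bar_boundariesI [of d 1 F] d(1) by (simp add: numeral_2_eq_2)
  from bar_boundaries_add [OF r(2) this] r(1) show ?thesis
    by auto
qed

text \<open>In first homology \<open>(x, y)\<close> is the sum of \<open>(x, 1)\<close> and
  \<open>(1, y)\<close>. Replacing \<open>x\<close> and \<open>y\<close> by kernel representatives
  \<open>r\<close> and \<open>s\<close> leads to \<open>(r, s)\<close>, which lies in the fiber
  product.\<close>

lemma fiber_product_H1_surj:
  assumes H1: "bar_cycles 1 Q \<subseteq> bar_boundaries 1 Q" and c: "c \<in> bar_chains 1 (F \<times>\<times> F)"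
  shows "\<exists>d\<in>bar_chains 1 P. c - d \<in> bar_boundaries 1 (F \<times>\<times> F)"
  using c
proof (induction rule: frag_span_induct)
  case zero
  show ?case
    by (rule bexI [of _ 0]) auto
next
  case (of l)
  then obtain x y where xy: "l = [(x, y)]" "x \<in> carrier F" "y \<in> carrier F"
    by (auto simp: length_Suc_conv)
  obtain r where r: "r \<in> K" "frag_of [x] - frag_of [r] \<in> bar_boundaries 1 F"
    using kernel_representative [OF H1 xy(2)] by blast
  obtain s where s: "s \<in> K" "frag_of [y] - frag_of [s] \<in> bar_boundaries 1 F"
    using kernel_representative [OF H1 xy(3)] by blast
  have rs: "r \<in> carrier F" "s \<in> carrier F" "(r, s) \<in> carrier P"
    using r s by (auto simp: kernel_def carrier_P)
  have split: "frag_of [(\<one>\<^bsub>F\<^esub>, b)] - frag_of [(a, b)] + frag_of [(a, \<one>\<^bsub>F\<^esub>)] \<in> bar_boundaries 1 (F \<times>\<times> F)"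
    if "a \<in> carrier F" "b \<in> carrier F" for a b
    using pair_in_boundaries [OF DirProd_group [OF group_F group_F], of "(a, \<one>\<^bsub>F\<^esub>)" "(\<one>\<^bsub>F\<^esub>, b)"] that
    by simp
  have "frag_of [(x, \<one>\<^bsub>F\<^esub>)] - frag_of [(r, \<one>\<^bsub>F\<^esub>)] \<in> bar_boundaries 1 (F \<times>\<times> F)"
    "frag_of [(\<one>\<^bsub>F\<^esub>, y)] - frag_of [(\<one>\<^bsub>F\<^esub>, s)] \<in> bar_boundaries 1 (F \<times>\<times> F)"
    using bar_boundaries_map [OF DirProd_inl_hom [OF group_F] r(2)]
      bar_boundaries_map [OF DirProd_inr_hom [OF group_F] s(2)] by (auto simp: bar_map_linear)
  from bar_boundaries_add [OF bar_boundaries_add [OF this]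
      bar_boundaries_diff [OF split [OF rs(1,2)] split [OF xy(2,3)]]]
  have "frag_of l - frag_of [(r, s)] \<in> bar_boundaries 1 (F \<times>\<times> F)"
    by (simp add: xy(1))
  then show ?case
    using rs(3) by (intro bexI [of _ "frag_of [(r, s)]"]) auto
next
  case (diff a b)
  then obtain a' b' where ab: "a' \<in> bar_chains 1 P" "b' \<in> bar_chains 1 P"
    "a - a' \<in> bar_boundaries 1 (F \<times>\<times> F)" "b - b' \<in> bar_boundaries 1 (F \<times>\<times> F)"
    by blast
  from bar_boundaries_diff [OF ab(3,4)]
  have "a - b - (a' - b') \<in> bar_boundaries 1 (F \<times>\<times> F)"
    by (simp add: algebra_simps)
  with ab(1,2) show ?case
    by (blast intro: frag_span_diff)
qed

text \<open>For \<open>r\<close> and \<open>s\<close> in the kernel, \<open>(r, 1)\<close> and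
  \<open>(1, s)\<close> lie in the fiber product, and they commute.\<close>

lemma cross_sum_cycle:
  assumes "k \<in> frag_span (K \<times> K)"
  shows "bar_cross_sum F F k \<in> bar_cycles 2 P"
  using assms
proof (induction rule: frag_span_induct)
  case (of a)
  then show ?case
    by (auto simp: bar_cross_def bar_cycles_def kernel_def carrier_P bar_linear bar_boundary_pair
        intro!: frag_span_diff)
qed (auto simp: bar_cross_sum_linear bar_cycles_diff, simp add: bar_cycles_def bar_boundary_linear)

text \<open>
  The bounding chain consists of degenerate simplices \<open>[r|1|1]\<close> and \<open>[1|1|r]\<close> with \<open>r\<close> in the
  kernel, hence its image is a multiple of \<open>[1|1|1] = \<partial>[1|1|1|1]\<close>.
\<close>

lemma cross_sum_fst_snd:
  assumes "k \<in> frag_span (K \<times> K)"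
  obtains a where "a \<in> bar_chains 3 F" "bar_map p a \<in> bar_boundaries 3 Q"
    "bar_boundary F a = bar_map fst (bar_cross_sum F F k) - bar_map snd (bar_cross_sum F F k)"
proof -
  \<comment> \<open>The boundary of \<open>?e r\<close> is \<open>[r, 1] - [1, r]\<close>, the first
    projection of the cross product of \<open>(r, 1)\<close> and \<open>(1, s)\<close>. The second
    projection is minus the boundary of \<open>?e s\<close>.\<close>
  let ?e = "\<lambda>r. - frag_of [r, \<one>\<^bsub>F\<^esub>, \<one>\<^bsub>F\<^esub>] - frag_of [\<one>\<^bsub>F\<^esub>, \<one>\<^bsub>F\<^esub>, r]"
  have "bar_boundary Q (frag_of [\<one>\<^bsub>Q\<^esub>, \<one>\<^bsub>Q\<^esub>, \<one>\<^bsub>Q\<^esub>, \<one>\<^bsub>Q\<^esub>]) = frag_of [\<one>\<^bsub>Q\<^esub>, \<one>\<^bsub>Q\<^esub>, \<one>\<^bsub>Q\<^esub>]"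
    by (simp add: bar_boundary_Cons_Cons bar_linear)
  then have deg: "frag_of [\<one>\<^bsub>Q\<^esub>, \<one>\<^bsub>Q\<^esub>, \<one>\<^bsub>Q\<^esub>] \<in> bar_boundaries 3 Q"
    using bar_boundariesI [of "frag_of [\<one>\<^bsub>Q\<^esub>, \<one>\<^bsub>Q\<^esub>, \<one>\<^bsub>Q\<^esub>, \<one>\<^bsub>Q\<^esub>]" 3 Q] by simp
  define E where "E = frag_extend (\<lambda>(r, s). ?e r + ?e s)"
  show ?thesis
  proof
    show "E k \<in> bar_chains 3 F"
      unfolding E_def using assms
      by (rule frag_span_extend) (auto simp: kernel_def intro!: frag_span_arith)
    show "bar_boundary F (E k) = bar_map fst (bar_cross_sum F F k) - bar_map snd (bar_cross_sum F F k)"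
      using assms by (rule frag_span_linear_eq)
        (auto simp: E_def bar_linear bar_map_linear bar_cross_sum_linear bar_cross_def kernel_def
          bar_boundary_triple)
    show "bar_map p (E k) \<in> bar_boundaries 3 Q"
      using assms
    proof (induction rule: frag_span_induct)
      case (of a)
      then show ?case
        using deg by (auto simp: E_def kernel_def bar_map_linear intro!: bar_boundaries_arith)
    qed (simp_all add: E_def frag_linear bar_map_linear bar_boundaries_diff)
  qed
qed

text \<open>Perfectness of \<open>Q\<close> lets the kernel serve as both sets of representatives,
  and this is what puts the cross products into the fiber product.\<close>

lemma free_DirProd_cycle_2_kernel:
  assumes "free_group F" "bar_cycles 1 Q \<subseteq> bar_boundaries 1 Q" "z \<in> bar_cycles 2 (F \<times>\<times> F)"
  obtains k where "k \<in> frag_span (K \<times> K)" "z - bar_cross_sum F F k \<in> bar_boundaries 2 (F \<times>\<times> F)"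
proof -
  have K: "K \<subseteq> carrier F"
    by (auto simp: kernel_def)
  note rep = kernel_representative [OF assms(2)]
  show ?thesis
    by (rule free_DirProd_cycle_2 [OF group_F group_F assms(1,1,3) K rep K rep that])
qed

section \<open>The two claims\<close>

theorem homologically_2_connected_fiber_product:
  assumes "free_group F" and H1: "bar_cycles 1 Q \<subseteq> bar_boundaries 1 Q"
    and H2: "bar_cycles 2 Q \<subseteq> bar_boundaries 2 Q"
  shows "homologically_2_connected P (F \<times>\<times> F) (\<lambda>z. z)"
proof -
  have id: "bar_map (\<lambda>z. z) c = c" for c :: "('f \<times> 'f) list \<Rightarrow>\<^sub>0 int"
    by (simp add: bar_map_eq_frag_map)
  note FF = DirProd_group [OF group_F group_F]
  have "homology_map 1 (F \<times>\<times> F) (\<lambda>z. z) \<in> iso (group_homology 1 P) (group_homology 1 (F \<times>\<times> F))"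
    using fiber_product_H1_surj [OF H1] fiber_product_H1_inj [OF H2]
    by (intro homology_map_iso group_P FF incl_hom) (simp_all only: id bar_cycles_1)
  moreover have "homology_map 2 (F \<times>\<times> F) (\<lambda>z. z) \<in> epi (group_homology 2 P) (group_homology 2 (F \<times>\<times> F))"
  proof (intro homology_map_epi group_P FF incl_hom)
    fix z assume "z \<in> bar_cycles 2 (F \<times>\<times> F)"
    with assms(1) H1 obtain k where "k \<in> frag_span (K \<times> K)"
      "z - bar_cross_sum F F k \<in> bar_boundaries 2 (F \<times>\<times> F)"
      by (rule free_DirProd_cycle_2_kernel)
    then show "\<exists>d\<in>bar_cycles 2 P. z - bar_map (\<lambda>z. z) d \<in> bar_boundaries 2 (F \<times>\<times> F)"
      unfolding id using cross_sum_cycle by blast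
  qed
  ultimately show ?thesis
    unfolding homologically_2_connected_def using group_P FF incl_hom by blast
qed

theorem H3_trivial:
  assumes free: "free_group F" and H1: "bar_cycles 1 Q \<subseteq> bar_boundaries 1 Q"
    and inj: "\<And>c. c \<in> bar_cycles 2 P \<Longrightarrow> c \<in> bar_boundaries 2 (F \<times>\<times> F) \<Longrightarrow> c \<in> bar_boundaries 2 P"
  shows "bar_cycles 3 Q \<subseteq> bar_boundaries 3 Q"
proof
  fix z assume "z \<in> bar_cycles 3 Q"
  then have z: "z \<in> bar_chains 3 Q" "bar_boundary Q z = 0"
    by (auto simp: bar_cycles_def)
  obtain y where y: "y \<in> bar_chains 3 F" "bar_map p y = z"
    using z(1) by (rule lift_chain)
  have "bar_boundary F y \<in> bar_boundaries 2 F"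
    using bar_boundariesI [of y 2 F] y(1) by simp
  then have "bar_boundary F y \<in> bar_cycles 2 F"
    using bar_boundaries_subset_cycles [OF group_F] by blast
  moreover have "bar_map p (bar_boundary F y) = 0"
    using bar_boundary_map [OF hom y(1)] y(2) z(2) by simp
  ultimately obtain w where w: "w \<in> bar_cycles 2 P" "bar_boundary F y = bar_map fst w - bar_map snd w"
    by (rule cycle_2_fst_snd)
  have "w \<in> bar_cycles 2 (F \<times>\<times> F)"
    using bar_cycles_map [OF incl_hom w(1)] by (simp add: bar_map_eq_frag_map)
  with free H1 obtain k where k: "k \<in> frag_span (K \<times> K)"
    "w - bar_cross_sum F F k \<in> bar_boundaries 2 (F \<times>\<times> F)"
    by (rule free_DirProd_cycle_2_kernel)
  \<comment> \<open>Both terms are cycles of the fiber product, so injectivity carries the bounding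
    chain back from the product.\<close>
  then have "w - bar_cross_sum F F k \<in> bar_boundaries 2 P"
    using w(1) by (intro inj bar_cycles_diff cross_sum_cycle)
  then obtain t where t: "t \<in> bar_chains 3 P" "w - bar_cross_sum F F k = bar_boundary P t"
    by (auto simp: bar_boundaries_eq eval_nat_numeral)
  obtain a where a: "a \<in> bar_chains 3 F" "bar_map p a \<in> bar_boundaries 3 Q"
    "bar_boundary F a = bar_map fst (bar_cross_sum F F k) - bar_map snd (bar_cross_sum F F k)"
    using k(1) by (rule cross_sum_fst_snd)
  \<comment> \<open>The corrections account for the whole boundary of \<open>y\<close> and keep its
    class over \<open>Q\<close>: the image of \<open>a\<close> bounds, and the two projections of
    \<open>t\<close> have the same image.\<close>
  let ?c = "y - a - (bar_map fst t - bar_map snd t)"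
  have "w = bar_boundary P t + bar_cross_sum F F k"
    by (simp flip: t(2))
  then have "bar_boundary F y = bar_boundary F a + bar_boundary F (bar_map fst t - bar_map snd t)"
    by (simp add: w(2) a(3) boundary_fst_snd [OF t(1)] bar_map_linear)
  then have "bar_boundary F ?c = 0"
    by (simp add: bar_boundary_linear)
  moreover have "bar_map fst t \<in> bar_chains 3 F" "bar_map snd t \<in> bar_chains 3 F"
    using t(1) fst_hom snd_hom by (auto simp: hom_def intro!: bar_map_chain [of _ P F])
  ultimately have "?c \<in> bar_boundaries 3 F"
    using F.free_group_acyclic [OF free, of 3] y(1) a(1)
    by (auto simp: bar_cycles_def intro!: frag_span_diff)
  from bar_boundaries_add [OF bar_boundaries_map [OF hom this] a(2)]
  show "z \<in> bar_boundaries 3 Q"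
    using map_fst_eq_map_snd [OF t(1)] y(2) by (simp add: bar_map_linear)
qed

end

theorem mainTheorem2:
  fixes Q :: "('q, 'n) monoid_scheme"
    and F :: "('f, 'm) monoid_scheme"
    and R :: "('r, 'k) monoid_scheme"
    and j :: "'r \<Rightarrow> 'f"
    and p :: "'f \<Rightarrow> 'q"
  assumes "super_perfect Q"
    and "free_group F"
    and "group_extension R j F p Q"
  shows "homologically_2_connected (fiber_product F p) (F \<times>\<times> F) (\<lambda>z. z) \<and>
    (kernel (group_homology 2 (fiber_product F p)) (group_homology 2 (F \<times>\<times> F))
        (homology_map 2 (F \<times>\<times> F) (\<lambda>z. z))
       = {\<one>\<^bsub>group_homology 2 (fiber_product F p)\<^esub>}
     \<longrightarrow> trivial_group (group_homology 3 Q))"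
proof (intro conjI impI)
  interpret group_epi F Q p
    using assms(3) by (simp add: group_epi_def group_extension_def)
  have H1: "bar_cycles 1 Q \<subseteq> bar_boundaries 1 Q" and H2: "bar_cycles 2 Q \<subseteq> bar_boundaries 2 Q"
    using assms(1) group_Q by (auto simp: super_perfect_def trivial_group_homology_iff)
  show "homologically_2_connected P (F \<times>\<times> F) (\<lambda>z. z)"
    using assms(2) H1 H2 by (rule homologically_2_connected_fiber_product)
  assume ker: "kernel (group_homology 2 P) (group_homology 2 (F \<times>\<times> F))
      (homology_map 2 (F \<times>\<times> F) (\<lambda>z. z)) = {\<one>\<^bsub>group_homology 2 P\<^esub>}"
  \<comment> \<open>Triviality of the kernel is restated for cycles; the inclusion acts as the
    identity on chains.\<close>
  have "c \<in> bar_boundaries 2 P" if "c \<in> bar_cycles 2 P" "c \<in> bar_boundaries 2 (F \<times>\<times> F)" for c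
    using homology_map_kernel_trivialD [OF incl_hom ker that(1)] that(2)
    by (simp add: bar_map_eq_frag_map)
  then have "bar_cycles 3 Q \<subseteq> bar_boundaries 3 Q"
    using assms(2) H1 by (intro H3_trivial)
  then show "trivial_group (group_homology 3 Q)"
    using trivial_group_homology_iff [OF group_Q] by blast
qed

end
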